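(* Let $\sigma\in(0,1)$, let $\Omega\subseteq\mathbb{R}^N$ be a bounded open set with boundary of class $C^2$, and let $\Phi:\Omega\times\mathbb{R}\to\mathbb{R}$ be a Carathéodory function with $\Phi(x,\cdot)$ non-decreasing for a.e. $x\in\Omega$. Let $\underline{w},\overline{w}\in L^1_\sigma(\mathbb{R}^N)\cap C^2(\Omega)$ be two functions satisfying $$\begin{cases}-\Delta\underline{w}+\Phi\big(\cdot,(-\Delta)^\sigma\underline{w}\big)\le-\Delta\overline{w}+\Phi\big(\cdot,(-\Delta)^\sigma\overline{w}\big)&\text{in }\Omega,\\ \underline{w}\le\overline{w}&\text{in }\mathbb{R}^N\setminus\overline{\Omega}.\end{cases}$$ Suppose in addition that, for any $x_0\in\partial\Omega$, $$[-\infty,+\infty)\ni\limsup_{\Omega\ni x\to x_0}\underline{w}(x)\le\liminf_{\Omega\ni x\to x_0}\overline{w}(x)\in(-\infty,+\infty].$$ Then $\underline{w}\le\overline{w}$ also in $\Omega$.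
   Context: $L^1_\sigma(\mathbb{R}^N)$ denotes the space of functions $v\in L^1_{\mathrm{loc}}(\mathbb{R}^N)$ for which $(1+|\cdot|)^{-N-2\sigma}v\in L^1(\mathbb{R}^N)$. $\Delta$ is the classical Laplacian and $(-\Delta)^\sigma$ is the fractional Laplacian, defined pointwise by $$(-\Delta)^\sigma u(x):=c_{N,\sigma}\lim_{\varepsilon\downarrow0}\int_{\mathbb{R}^N\setminus B_\varepsilon(x)}\frac{u(x)-u(y)}{|x-y|^{N+2\sigma}}\,dy,$$ where $c_{N,\sigma}>0$ is the normalizing constant for which the Fourier symbol of $(-\Delta)^\sigma$ is $|\xi|^{2\sigma}$. It is well defined pointwise in $\Omega$ for functions in $L^1_\sigma(\mathbb{R}^N)\cap C^2(\Omega)$. *)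

theory Defs
  imports "HOL-Analysis.Analysis"
begin

text \<open>
  The definitions are stated for an arbitrary Euclidean space, whose dimension
  \<open>DIM('a)\<close> plays the role of \<open>N\<close>. "Measurable" and "almost everywhere" refer to
  Lebesgue measure throughout.
\<close>

definition L1_loc :: "('a::euclidean_space \<Rightarrow> real) set"
  where "L1_loc = {v. \<forall>K. compact K \<longrightarrow> v absolutely_integrable_on K}"

definition L1_weighted :: "real \<Rightarrow> ('a::euclidean_space \<Rightarrow> real) set"
  where "L1_weighted \<sigma> =
    {v \<in> L1_loc. integrable lebesgue
       (\<lambda>x. (1 + norm x) powr (- (real DIM('a) + 2 * \<sigma>)) * v x)}"

text \<open>
  \<open>C2_on S f\<close> is meant for open \<open>S\<close>: the first and second Frechet derivatives
  exist on \<open>S\<close> and the second one is continuous there. Derivatives are taken in the whole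
  space, and nothing is required of \<open>f\<close> outside \<open>S\<close>.
\<close>

definition C2_on :: "'a::euclidean_space set \<Rightarrow> ('a \<Rightarrow> real) \<Rightarrow> bool"
  where "C2_on S f \<longleftrightarrow>
    (\<exists>(f' :: 'a \<Rightarrow> 'a \<Rightarrow>\<^sub>L real) (f'' :: 'a \<Rightarrow> 'a \<Rightarrow>\<^sub>L ('a \<Rightarrow>\<^sub>L real)).
       (\<forall>x\<in>S. (f has_derivative blinfun_apply (f' x)) (at x)) \<and>
       (\<forall>x\<in>S. (f' has_derivative blinfun_apply (f'' x)) (at x)) \<and>
       continuous_on S f'')"

text \<open>
  Boundary of class \<open>C\<^sup>2\<close>: near each boundary point, and up to a rotation of the axes,
  \<open>S\<close> is the region strictly above the graph of a \<open>C\<^sup>2\<close> function of \<open>N - 1\<close> variables.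
  The vector \<open>\<nu>\<close> is the direction of the last axis after the rotation; a function of the
  remaining \<open>N - 1\<close> coordinates is encoded as a function on the whole space that is
  invariant under translations along \<open>\<nu>\<close>.
\<close>

definition C2_boundary :: "'a::euclidean_space set \<Rightarrow> bool"
  where "C2_boundary S \<longleftrightarrow>
    (\<forall>x0\<in>frontier S. \<exists>\<nu> r \<gamma>. norm \<nu> = 1 \<and> 0 < r \<and> C2_on UNIV \<gamma> \<and>
       (\<forall>x t. \<gamma> (x + t *\<^sub>R \<nu>) = \<gamma> x) \<and>
       S \<inter> ball x0 r = {x \<in> ball x0 r. \<gamma> x < x \<bullet> \<nu>})"

definition partial_deriv :: "'a::euclidean_space \<Rightarrow> ('a \<Rightarrow> real) \<Rightarrow> 'a \<Rightarrow> real"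
  where "partial_deriv b f x = deriv (\<lambda>t. f (x + t *\<^sub>R b)) 0"

definition laplacian :: "('a::euclidean_space \<Rightarrow> real) \<Rightarrow> 'a \<Rightarrow> real"
  where "laplacian f x = (\<Sum>b\<in>Basis. partial_deriv b (partial_deriv b f) x)"

text \<open>
  The principal value integral without its normalizing constant. The codomain is left
  general because it is applied both to real functions and to complex plane waves.
\<close>

definition pv_integral ::
    "real \<Rightarrow> ('a::euclidean_space \<Rightarrow> 'b::{banach, second_countable_topology}) \<Rightarrow> 'a \<Rightarrow> 'b"
  where "pv_integral \<sigma> u x =
    Lim (at_right 0) (\<lambda>\<epsilon>. LINT y:(- ball x \<epsilon>)|lebesgue.
      (u x - u y) /\<^sub>R (norm (x - y) powr (real DIM('a) + 2 * \<sigma>)))"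

text \<open>
  The constant \<open>c\<close> that makes the operator have Fourier symbol \<open>|\<xi>| powr (2\<sigma>)\<close>: each
  plane wave \<open>y \<mapsto> exp (i \<xi> \<bullet> y)\<close> is multiplied by the symbol.
\<close>

definition frac_const :: "'a::euclidean_space itself \<Rightarrow> real \<Rightarrow> real"
  where "frac_const _ \<sigma> =
    (THE c. 0 < c \<and>
      (\<forall>(\<xi>::'a) x. c *\<^sub>R pv_integral \<sigma> (\<lambda>y. cis (\<xi> \<bullet> y)) x
                     = (norm \<xi> powr (2 * \<sigma>)) *\<^sub>R cis (\<xi> \<bullet> x)))"

definition frac_laplacian :: "real \<Rightarrow> ('a::euclidean_space \<Rightarrow> real) \<Rightarrow> 'a \<Rightarrow> real"
  where "frac_laplacian \<sigma> u x = frac_const TYPE('a) \<sigma> * pv_integral \<sigma> u x"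

text \<open>Only the values of \<open>\<Phi> x t\<close> with \<open>x \<in> S\<close> matter.\<close>

definition caratheodory_fun :: "'a::euclidean_space set \<Rightarrow> ('a \<Rightarrow> real \<Rightarrow> real) \<Rightarrow> bool"
  where "caratheodory_fun S \<Phi> \<longleftrightarrow>
    (\<forall>t. (\<lambda>x. \<Phi> x t) \<in> borel_measurable (lebesgue_on S)) \<and>
    (AE x in lebesgue_on S. continuous_on UNIV (\<Phi> x))"

end

theory Submission
  imports Defs
begin

text \<open>
  Suppose that \<open>w = w1 - w2\<close> is positive somewhere in \<open>\<Omega>\<close>. By the boundary condition the
  positive superlevel sets of \<open>w\<close> are compact in \<open>\<Omega>\<close>, so \<open>w\<close> has a positive maximum, and
  since \<open>frontier \<Omega>\<close> is a null set this maximum bounds \<open>w\<close> almost everywhere. At every maximum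
  point the principal value integral of \<open>w\<close> is strictly positive, hence it is positive in a whole
  neighbourhood by continuity. The monotonicity of \<open>\<Phi>\<close>, available only almost everywhere, then
  gives \<open>laplacian w \<ge> 0\<close> almost everywhere in this neighbourhood, and therefore everywhere by
  continuity. But maximum points of \<open>w + \<epsilon> |x|\<^sup>2\<close> accumulate, as \<open>\<epsilon> \<down> 0\<close>, at a maximum
  point of \<open>w\<close>, and at them \<open>laplacian w \<le> - 2 N \<epsilon> < 0\<close>.

  The constant \<open>frac_const\<close> is a definite description, so its positivity needs the Fourier symbol:
  the principal value of a plane wave \<open>y \<mapsto> exp (i \<xi> \<bullet> y)\<close> is computed up to a positive factor
  from the behaviour of the kernel under dilations and orthogonal maps.
\<close>

section \<open>Lebesgue measure: power weights, translations and orthogonal maps\<close>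

text \<open>The n-th shell has radii comparable to r q^n: the weight there is at most (r q^n)^(-a),
  and the volume is at most a constant times (r q^n)^N. The integral is thus bounded by a geometric
  series of ratio q^(N - a). The choice q = 1/2 serves the singularity at the origin, q = 2 the tail
  at infinity.\<close>

lemma nn_integral_norm_powr_shells:
  fixes A :: "'a::euclidean_space set"
  assumes q: "0 < q" "q powr (real DIM('a) - a) < 1" and r: "0 < r" and a: "0 \<le> a"
    and A: "\<And>z. z \<in> A \<Longrightarrow> \<exists>n. r * q ^ n \<le> norm z \<and> norm z \<le> 2 * (r * q ^ n)"
  shows "(\<integral>\<^sup>+z. ennreal (norm z powr (- a)) * indicator A z \<partial>lborel) < \<infinity>"
proof -
  let ?N = "DIM('a)"
  let ?c = "\<lambda>n. (r * q ^ n) powr (- a)"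
  define v where "v = unit_ball_vol (real ?N)"
  have v: "0 \<le> v" unfolding v_def by simp
  have le: "ennreal (norm z powr (- a)) * indicator A z
      \<le> (\<Sum>n. ennreal (?c n) * indicator (cball 0 (2 * (r * q ^ n))) z)" for z :: 'a
  proof (cases "z \<in> A")
    case True
    then obtain n where n: "r * q ^ n \<le> norm z" "norm z \<le> 2 * (r * q ^ n)" using A by blast
    have "ennreal (norm z powr (- a)) \<le> ennreal (?c n)"
      using n r q a by (intro ennreal_leI powr_mono2') auto
    also have "\<dots> = ennreal (?c n) * indicator (cball 0 (2 * (r * q ^ n))) z"
      using n by simp
    also have "\<dots> = (\<Sum>i\<in>{n}. ennreal (?c i) * indicator (cball 0 (2 * (r * q ^ i))) z)"
      by (simp only: sum.insert sum.empty finite.emptyI empty_iff not_False_eq_True add_0_right)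
    also have "\<dots> \<le> (\<Sum>i. ennreal (?c i) * indicator (cball 0 (2 * (r * q ^ i))) z)"
      by (rule sum_le_suminf) auto
    finally show ?thesis using True by simp
  qed auto
  have pw: "?c n * (2 * (r * q ^ n)) ^ ?N = (2 * r) ^ ?N * r powr (- a) * (q powr (real ?N - a)) ^ n" for n
  proof -
    have "(q ^ n) powr (- a) * (q ^ n) ^ ?N = (q powr (real ?N - a)) ^ n"
    proof -
      have "(q ^ n) powr (- a) * (q ^ n) ^ ?N = (q ^ n) powr (- a) * (q ^ n) powr real ?N"
        using q by (simp add: powr_realpow)
      also have "\<dots> = (q ^ n) powr (real ?N - a)" by (simp flip: powr_add)
      also have "\<dots> = (q powr (real ?N - a)) ^ n"
        using q by (simp add: powr_powr mult.commute flip: powr_realpow)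
      finally show ?thesis .
    qed
    moreover have "?c n = r powr (- a) * (q ^ n) powr (- a)" using r q by (simp add: powr_mult)
    ultimately show ?thesis by (simp add: power_mult_distrib mult_ac)
  qed
  have "(\<integral>\<^sup>+z. ennreal (norm z powr (- a)) * indicator A z \<partial>lborel)
      \<le> (\<integral>\<^sup>+z. (\<Sum>n. ennreal (?c n) * indicator (cball 0 (2 * (r * q ^ n))) (z::'a)) \<partial>lborel)"
    by (intro nn_integral_mono le)
  also have "\<dots> = (\<Sum>n. ennreal (?c n) * emeasure lborel (cball (0::'a) (2 * (r * q ^ n))))"
    by (subst nn_integral_suminf)
      (simp_all only: nn_integral_cmult_indicator borel_closed closed_cball sets_lborel
        borel_measurable_times_ennreal borel_measurable_const borel_measurable_indicator)
  also have "\<dots> = (\<Sum>n. ennreal (v * ((2 * r) ^ ?N * r powr (- a)) * (q powr (real ?N - a)) ^ n))"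
  proof (intro suminf_cong)
    fix n
    have "ennreal (?c n) * emeasure lborel (cball (0::'a) (2 * (r * q ^ n)))
        = ennreal (?c n * (v * (2 * (r * q ^ n)) ^ ?N))"
      using q r v by (simp add: emeasure_cball v_def ennreal_mult)
    also have "?c n * (v * (2 * (r * q ^ n)) ^ ?N)
        = v * ((2 * r) ^ ?N * r powr (- a)) * (q powr (real ?N - a)) ^ n"
      using pw[of n] by (simp add: mult_ac)
    finally show "ennreal (?c n) * emeasure lborel (cball (0::'a) (2 * (r * q ^ n)))
        = ennreal (v * ((2 * r) ^ ?N * r powr (- a)) * (q powr (real ?N - a)) ^ n)" .
  qed
  also have "\<dots> < \<infinity>"
  proof -
    have "summable (\<lambda>n. v * ((2 * r) ^ ?N * r powr (- a)) * (q powr (real ?N - a)) ^ n)"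
      using q by (intro summable_mult summable_geometric) auto
    then have "(\<Sum>n. ennreal (v * ((2 * r) ^ ?N * r powr (- a)) * (q powr (real ?N - a)) ^ n)) \<noteq> top"
      using v r by (intro ennreal_suminf_neq_top) auto
    then show ?thesis by (simp add: top.not_eq_extremum)
  qed
  finally show ?thesis .
qed

text \<open>Supplies the index of a shell that contains a given point; t is a quotient of
  \<open>r\<close> and the norm of the point.\<close>

lemma ex_power2_bracket:
  fixes t :: real
  assumes "1 \<le> t"
  shows "\<exists>n. 2 ^ n \<le> t \<and> t \<le> 2 * 2 ^ n"
proof -
  define n where "n = nat \<lfloor>log 2 t\<rfloor>"
  have l: "0 \<le> log 2 t" using assms by simp
  have "real n \<le> log 2 t" "log 2 t \<le> real n + 1"
    unfolding n_def using l by linarith+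
  then have "2 powr real n \<le> t" "t \<le> 2 powr (real n + 1)"
    using assms by (simp_all add: le_log_iff log_le_iff)
  then show ?thesis by (auto simp: powr_realpow powr_add intro!: exI[of _ n])
qed

lemma integrable_lborel_imp_lebesgue:
  fixes f :: "'a::euclidean_space \<Rightarrow> 'b::{banach, second_countable_topology}"
  assumes "integrable lborel f"
  shows "integrable lebesgue f"
  using assms by (simp only: integrable_completion[OF borel_measurable_integrable[OF assms]])

lemma integrable_norm_powr_ball:
  fixes r :: real
  assumes a: "0 \<le> a" "a < real DIM('a::euclidean_space)" and r: "0 < r"
  shows "integrable lebesgue (\<lambda>z::'a. indicat_real (ball 0 r) z * norm z powr (- a))"
proof -
  \<comment> \<open>Shells starting at radius r/2 reach out to 2 (r/2) = r. The origin lies in no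
    shell and is left out.\<close>
  have "(\<integral>\<^sup>+z. ennreal (norm z powr (- a)) * indicator (ball 0 r - {0::'a}) z \<partial>lborel) < \<infinity>"
  proof (rule nn_integral_norm_powr_shells[where q="1/2" and r="r/2"])
    show "(1/2::real) powr (real DIM('a) - a) < 1"
      using a powr_less_mono2[of "real DIM('a) - a" "1/2" 1] by simp
    fix z :: 'a assume z: "z \<in> ball 0 r - {0}"
    then have "1 \<le> r / norm z" by simp
    then obtain n where "2 ^ n \<le> r / norm z" "r / norm z \<le> 2 * 2 ^ n"
      using ex_power2_bracket by blast
    then show "\<exists>n. r / 2 * (1 / 2) ^ n \<le> norm z \<and> norm z \<le> 2 * (r / 2 * (1 / 2) ^ n)"
      using z r by (intro exI[of _ n]) (auto simp: field_simps power_divide)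
  qed (use a r in auto)
  \<comment> \<open>The origin can be put back because \<open>0 powr (- a)\<close> is 0.\<close>
  also have "(\<integral>\<^sup>+z. ennreal (norm z powr (- a)) * indicator (ball 0 r - {0::'a}) z \<partial>lborel)
      = (\<integral>\<^sup>+z. ennreal (norm (indicat_real (ball (0::'a) r) z * norm z powr (- a))) \<partial>lborel)"
    by (intro nn_integral_cong) (auto simp: indicator_def)
  finally have "integrable lborel (\<lambda>z::'a. indicat_real (ball 0 r) z * norm z powr (- a))"
    by (intro integrableI_bounded borel_measurable_times borel_measurable_indicator) auto
  then show ?thesis by (rule integrable_lborel_imp_lebesgue)
qed

lemma integrable_norm_powr_tail:
  fixes r :: real
  assumes a: "real DIM('a::euclidean_space) < a" and r: "0 < r"
  shows "integrable lebesgue (\<lambda>z::'a. indicat_real (- ball 0 r) z * norm z powr (- a))"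
proof -
  have "(\<integral>\<^sup>+z. ennreal (norm z powr (- a)) * indicator (- ball (0::'a) r) z \<partial>lborel) < \<infinity>"
  proof (rule nn_integral_norm_powr_shells[where q=2 and r=r])
    show "(2::real) powr (real DIM('a) - a) < 1"
      using a by (simp add: powr_less_one)
    fix z :: 'a assume z: "z \<in> - ball 0 r"
    then have "1 \<le> norm z / r" using r by simp
    then obtain n where "2 ^ n \<le> norm z / r" "norm z / r \<le> 2 * 2 ^ n"
      using ex_power2_bracket by blast
    then show "\<exists>n. r * 2 ^ n \<le> norm z \<and> norm z \<le> 2 * (r * 2 ^ n)"
      using z r by (intro exI[of _ n]) (auto simp: field_simps)
  qed (use a r in auto)
  also have "(\<integral>\<^sup>+z. ennreal (norm z powr (- a)) * indicator (- ball (0::'a) r) z \<partial>lborel)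
      = (\<integral>\<^sup>+z. ennreal (norm (indicat_real (- ball (0::'a) r) z * norm z powr (- a))) \<partial>lborel)"
    by (intro nn_integral_cong) (auto simp: indicator_def)
  finally have "integrable lborel (\<lambda>z::'a. indicat_real (- ball 0 r) z * norm z powr (- a))"
    by (intro integrableI_bounded borel_measurable_times borel_measurable_indicator) auto
  then show ?thesis by (rule integrable_lborel_imp_lebesgue)
qed

section \<open>Translation invariance of Lebesgue measure\<close>

lemma distr_lebesgue_shift: "distr lebesgue lebesgue ((+) x) = (lebesgue :: 'a::euclidean_space measure)"
  and measurable_lebesgue_shift: "(+) x \<in> (lebesgue :: 'a measure) \<rightarrow>\<^sub>M lebesgue"
proof -
  \<comment> \<open>A translation is the coordinatewise affine map with all stretching factors equal
    to 1.\<close>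
  have eq: "(\<lambda>z. x + (\<Sum>j\<in>Basis. (1 * (z \<bullet> j)) *\<^sub>R j)) = (+) (x::'a)"
    by (simp add: euclidean_representation fun_eq_iff)
  show "distr lebesgue lebesgue ((+) x) = (lebesgue :: 'a measure)"
    using lebesgue_affine_euclidean[of "\<lambda>_. 1" x] by (simp only: eq) (simp add: density_1)
  show "(+) x \<in> (lebesgue :: 'a measure) \<rightarrow>\<^sub>M lebesgue"
    using lebesgue_affine_measurable[of "\<lambda>_. 1" x] by (simp only: eq)
qed

lemma borel_measurable_lebesgue_shift:
  assumes "f \<in> borel_measurable (lebesgue :: 'a::euclidean_space measure)"
  shows "(\<lambda>z. f (x + z)) \<in> borel_measurable lebesgue"
  using measurable_comp[OF measurable_lebesgue_shift assms] by (simp add: o_def)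

lemma integrable_lebesgue_shift_iff:
  fixes f :: "'a::euclidean_space \<Rightarrow> 'b::{banach, second_countable_topology}"
  assumes "f \<in> borel_measurable lebesgue"
  shows "integrable lebesgue (\<lambda>z. f (x + z)) \<longleftrightarrow> integrable lebesgue f"
  using integrable_distr_eq[OF measurable_lebesgue_shift assms, of x] by (simp add: distr_lebesgue_shift)

lemma integral_lebesgue_shift:
  fixes f :: "'a::euclidean_space \<Rightarrow> 'b::{banach, second_countable_topology}"
  assumes "f \<in> borel_measurable lebesgue"
  shows "(\<integral>z. f (x + z) \<partial>lebesgue) = integral\<^sup>L lebesgue f"
  using integral_distr[OF measurable_lebesgue_shift assms, of x] by (simp add: distr_lebesgue_shift)

section \<open>Invariance of Lebesgue measure under orthogonal maps\<close>

text \<open>By Vitali's theorem an open set is, up to a null set, a disjoint union of countably many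
  balls, and an isometry maps balls to balls of the same radius.\<close>

lemma orthogonal_transformation_emeasure_ge:
  fixes Q :: "'a::euclidean_space \<Rightarrow> 'a"
  assumes Q: "orthogonal_transformation Q" and U: "open U"
  shows "emeasure lborel U \<le> emeasure lborel (Q -` U)"
proof -
  let ?K = "{(c, d). 0 < d \<and> ball c d \<subseteq> U}"
  have cont: "continuous_on UNIV Q"
    using orthogonal_transformation_linear[OF Q] by (simp add: linear_continuous_on linear_linear)
  have cov: "\<exists>i. i \<in> ?K \<and> x \<in> ball (fst i) (snd i) \<and> snd i < d" if "x \<in> U" "0 < d" for x d
  proof -
    obtain e where e: "0 < e" "ball x e \<subseteq> U" using U \<open>x \<in> U\<close> openE by blast
    \<comment> \<open>Halving \<open>d\<close> gives the strict bound on the radius that a Vitali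
      cover requires.\<close>
    then have "ball x (min e (d/2)) \<subseteq> U" using subset_ball[of "min e (d/2)" e x] by auto
    then show ?thesis using e \<open>0 < d\<close> by (intro exI[of _ "(x, min e (d/2))"]) auto
  qed
  obtain C where C: "countable C" "C \<subseteq> ?K"
     "pairwise (\<lambda>i j. disjnt (ball (fst i) (snd i)) (ball (fst j) (snd j))) C"
     "negligible (U - (\<Union>i \<in> C. ball (fst i) (snd i)))"
    by (rule Vitali_covering_theorem_balls[of U ?K fst snd, OF cov])
  let ?B = "\<lambda>i. ball (fst i) (snd i)"
  have dj: "disjoint_family_on ?B C"
    using C(3) by (auto simp: disjoint_family_on_def pairwise_def disjnt_def)
  have dj': "disjoint_family_on (\<lambda>i. Q -` ?B i) C"
    using dj unfolding disjoint_family_on_def vimage_Int[symmetric] by (metis vimage_empty)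
  have pre: "Q -` ball (Q c) d = ball c d" for c d
    using Q by (auto simp: orthogonal_transformation_isometry)
  have sur: "surj Q" using orthogonal_transformation_surj[OF Q] .
  have ball: "emeasure lborel (Q -` ball c d) = emeasure lborel (ball c d)" if "0 < d" for c d
  proof -
    obtain c' where "c = Q c'" using sur by (rule surjE)
    then show ?thesis using that by (simp add: pre emeasure_ball)
  qed
  have meas: "Q -` S \<in> sets borel" if "open S" for S
    using that cont by (simp add: open_vimage)
  have sub: "(\<Union>i\<in>C. ?B i) \<subseteq> U"
  proof (rule UN_least)
    show "?B i \<subseteq> U" if "i \<in> C" for i
      using subsetD[OF C(2) that] by (simp add: case_prod_beta)
  qed
  have "emeasure lborel U = emeasure lborel (\<Union>i\<in>C. ?B i)"
  proof (rule emeasure_eq_AE)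
    have "U - (\<Union>i\<in>C. ?B i) \<in> null_sets lborel"
    proof -
      have "U - (\<Union>i\<in>C. ?B i) \<in> sets borel" using U by (intro sets.Diff borel_open open_UN) auto
      then show ?thesis using C(4)
        by (simp add: negligible_iff_null_sets null_sets_completion_iff)
    qed
    then show "AE x in lborel. x \<in> U \<longleftrightarrow> x \<in> (\<Union>i\<in>C. ?B i)"
      by (rule AE_I'[where N="U - (\<Union>i\<in>C. ?B i)"]) (use sub in blast)
    show "U \<in> sets lborel" using U by simp
    show "(\<Union>i\<in>C. ?B i) \<in> sets lborel" by (simp add: open_UN)
  qed
  also have "\<dots> = (\<integral>\<^sup>+i. emeasure lborel (?B i) \<partial>count_space C)"
    using C(1) dj by (intro emeasure_UN_countable) auto
  also have "\<dots> = (\<integral>\<^sup>+i. emeasure lborel (Q -` ?B i) \<partial>count_space C)"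
    using C(2) by (intro nn_integral_cong) (auto simp: ball)
  also have "\<dots> = emeasure lborel (\<Union>i\<in>C. Q -` ?B i)"
    using C(1) dj' by (intro emeasure_UN_countable[symmetric]) (simp_all add: meas)
  also have "\<dots> \<le> emeasure lborel (Q -` U)"
    using sub U by (intro emeasure_mono) (auto simp: meas)
  finally show ?thesis .
qed

text \<open>The inequality for \<open>Q\<close>, together with the one for its inverse, gives
  equality on open sets. These form an intersection-stable generator of the Borel sets, and the
  balls around 0 exhaust the space with finite measure.\<close>

lemma distr_lborel_orthogonal_transformation:
  fixes Q :: "'a::euclidean_space \<Rightarrow> 'a"
  assumes Q: "orthogonal_transformation Q"
  shows "distr lborel borel Q = lborel"
proof -
  have meas: "Q \<in> borel \<rightarrow>\<^sub>M borel"
    using orthogonal_transformation_linear[OF Q]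
    by (intro borel_measurable_continuous_onI) (simp add: linear_continuous_on linear_linear)
  have inv: "orthogonal_transformation (inv Q)" using Q by (rule orthogonal_transformation_inv)
  have bij: "bij Q" using Q by (rule orthogonal_transformation_bij)
  have eq: "emeasure lborel (Q -` U) = emeasure lborel U" if "open U" for U
  proof (rule antisym)
    have "open (Q -` U)"
      using that orthogonal_transformation_linear[OF Q]
      by (simp add: open_vimage linear_continuous_on linear_linear)
    from orthogonal_transformation_emeasure_ge[OF inv this]
    show "emeasure lborel (Q -` U) \<le> emeasure lborel U"
      using bij by (simp add: vimage_def bij_is_surj surj_f_inv_f)
  qed (rule orthogonal_transformation_emeasure_ge[OF Q that])
  show ?thesis
  proof (rule measure_eqI_generator_eq[where E="{S. open S}" and \<Omega>=UNIV and A="\<lambda>n. ball 0 (real n)"])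
    show "emeasure (distr lborel borel Q) X = emeasure lborel X" if "X \<in> {S. open S}" for X
      using that meas eq[of X] by (simp add: emeasure_distr)
    show "(\<Union>i. ball (0::'a) (real i)) = UNIV" by (auto simp: reals_Archimedean2)
    show "emeasure (distr lborel borel Q) (ball 0 (real i)) \<noteq> \<infinity>" for i
      using meas eq[of "ball 0 (real i)"] by (simp add: emeasure_distr emeasure_ball)
  qed (auto simp: Int_stable_def borel_def)
qed

lemma integral_lebesgue_borel_eq:
  fixes f :: "'a::euclidean_space \<Rightarrow> 'b::{banach, second_countable_topology}"
  assumes "f \<in> borel_measurable borel"
  shows "integral\<^sup>L lebesgue f = integral\<^sup>L lborel f"
  using assms by (intro integral_completion) simp

lemma integral_orthogonal_transformation:
  fixes f :: "'a::euclidean_space \<Rightarrow> 'b::{banach, second_countable_topology}" and Q :: "'a \<Rightarrow> 'a"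
  assumes Q: "orthogonal_transformation Q" and f: "f \<in> borel_measurable borel"
  shows "(\<integral>z. f (Q z) \<partial>lborel) = integral\<^sup>L lborel f"
proof -
  have meas: "Q \<in> borel \<rightarrow>\<^sub>M borel"
    using orthogonal_transformation_linear[OF Q]
    by (intro borel_measurable_continuous_onI) (simp add: linear_continuous_on linear_linear)
  have "(\<integral>z. f (Q z) \<partial>lborel) = integral\<^sup>L (distr lborel borel Q) f"
    using meas f by (subst integral_distr) auto
  then show ?thesis by (simp add: distr_lborel_orthogonal_transformation[OF Q])
qed

section \<open>Principal values as absolutely convergent integrals\<close>

text \<open>Written with \<open>inverse\<close> so as to match the \<open>/\<^sub>R\<close> in
  \<open>pv_integral\<close>. At the origin it takes the default value 0.\<close>

definition rkernel :: "real \<Rightarrow> 'a::euclidean_space \<Rightarrow> real"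
  where "rkernel \<sigma> z = inverse (norm z powr (real DIM('a) + 2 * \<sigma>))"

lemma rkernel_nonneg: "0 \<le> rkernel \<sigma> z"
  by (simp add: rkernel_def)

lemma rkernel_pos: "z \<noteq> 0 \<Longrightarrow> 0 < rkernel \<sigma> z"
  by (simp add: rkernel_def)

lemma rkernel_0 [simp]: "rkernel \<sigma> 0 = 0"
  by (simp add: rkernel_def)

lemma rkernel_minus [simp]: "rkernel \<sigma> (- z) = rkernel \<sigma> z"
  by (simp add: rkernel_def)

lemma rkernel_powr: "rkernel \<sigma> (z::'a::euclidean_space) = norm z powr (- (real DIM('a) + 2 * \<sigma>))"
  by (simp add: rkernel_def powr_minus del: minus_add_distrib)

lemma borel_measurable_rkernel [measurable]: "rkernel \<sigma> \<in> borel_measurable borel"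
  unfolding rkernel_def[abs_def] by measurable

lemma borel_measurable_rkernel_lebesgue [measurable]: "rkernel \<sigma> \<in> borel_measurable lebesgue"
  using borel_measurable_rkernel by (simp add: measurable_completion)

lemma integrable_rkernel_tail:
  assumes "0 < \<sigma>" "0 < r"
  shows "integrable lebesgue (\<lambda>z::'a::euclidean_space. indicat_real (- ball 0 r) z * rkernel \<sigma> z)"
  unfolding rkernel_powr using assms by (intro integrable_norm_powr_tail) auto

text \<open>The factor |z|^2 comes from second order Taylor remainders. The product is |z|^(-(N + 2
  \<sigma> - 2)), and this exponent is above -N because \<sigma> < 1.\<close>

lemma integrable_rkernel_near:
  assumes "0 < \<sigma>" "\<sigma> < 1" "0 < r"
  shows "integrable lebesgue (\<lambda>z::'a::euclidean_space. indicat_real (ball 0 r) z * ((norm z)\<^sup>2 * rkernel \<sigma> z))"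
proof -
  \<comment> \<open>For N = 1 and \<sigma> < 1/2 the number N + 2 \<sigma> - 2 is negative. The
    product is then bounded on the ball, which the factor \<open>1 + r powr 2\<close> below accounts
    for.\<close>
  let ?m = "max 0 (real DIM('a) + 2 * \<sigma> - 2)"
  have "integrable lebesgue (\<lambda>z::'a. indicat_real (ball 0 r) z * norm z powr (- ?m))"
    using assms by (intro integrable_norm_powr_ball) auto
  then have "integrable lebesgue (\<lambda>z::'a. (1 + r powr (2 * \<sigma>)) * (1 + r powr 2) * (indicat_real (ball 0 r) z * norm z powr (- ?m)))"
    by (rule integrable_mult_right)
  then show ?thesis
  proof (rule Bochner_Integration.integrable_bound)
    show "(\<lambda>z::'a. indicat_real (ball 0 r) z * ((norm z)\<^sup>2 * rkernel \<sigma> z)) \<in> borel_measurable lebesgue"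
      by (intro borel_measurable_times borel_measurable_indicator borel_measurable_rkernel_lebesgue
          borel_measurable_power borel_measurable_norm) (auto intro: measurable_completion)
    show "AE z::'a in lebesgue. norm (indicat_real (ball 0 r) z * ((norm z)\<^sup>2 * rkernel \<sigma> z))
       \<le> norm ((1 + r powr (2 * \<sigma>)) * (1 + r powr 2) * (indicat_real (ball 0 r) z * norm z powr (- ?m)))"
    proof (rule AE_I2)
      fix z :: 'a
      show "norm (indicat_real (ball 0 r) z * ((norm z)\<^sup>2 * rkernel \<sigma> z))
       \<le> norm ((1 + r powr (2 * \<sigma>)) * (1 + r powr 2) * (indicat_real (ball 0 r) z * norm z powr (- ?m)))"
      proof (cases "z \<in> ball 0 r \<and> z \<noteq> 0")
        case True
        have c: "1 \<le> (1 + r powr (2 * \<sigma>)) * (1 + r powr 2)"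
          by (simp add: algebra_simps)
        have e: "(norm z)\<^sup>2 * rkernel \<sigma> z = norm z powr (- (real DIM('a) + 2 * \<sigma> - 2))"
        proof -
          have "(norm z)\<^sup>2 = norm z powr 2" using True by simp
          then have "(norm z)\<^sup>2 * rkernel \<sigma> z = norm z powr (2 + - (real DIM('a) + 2 * \<sigma>))"
            by (simp only: rkernel_powr powr_add)
          then show ?thesis by (simp add: algebra_simps)
        qed
        show ?thesis
        proof (cases "0 \<le> real DIM('a) + 2 * \<sigma> - 2")
          case True
          then show ?thesis unfolding e using c
            by (auto simp: abs_mult indicator_def mult_le_cancel_right1)
        next
          case False
          have "1 \<le> real DIM('a)" by (simp add: Suc_leI)
          then have ex: "0 \<le> - (real DIM('a) + 2 * \<sigma> - 2)" "- (real DIM('a) + 2 * \<sigma> - 2) \<le> 2"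
            using False assms by linarith+
          have "norm z powr (- (real DIM('a) + 2 * \<sigma> - 2)) \<le> r powr (- (real DIM('a) + 2 * \<sigma> - 2))"
            using True ex by (intro powr_mono2) auto
          also have "\<dots> \<le> 1 + r powr 2"
          proof (cases "r \<le> 1")
            case True
            then have "r powr (- (real DIM('a) + 2 * \<sigma> - 2)) \<le> 1"
              using ex assms by (intro powr_le1) auto
            then show ?thesis by (smt (verit) powr_ge_zero)
          next
            case False
            then have "r powr (- (real DIM('a) + 2 * \<sigma> - 2)) \<le> r powr 2"
              using ex by (intro powr_mono) auto
            then show ?thesis by simp
          qed
          also have "\<dots> \<le> (1 + r powr (2 * \<sigma>)) * (1 + r powr 2)"
            using mult_right_mono[of 1 "1 + r powr (2 * \<sigma>)" "1 + r powr 2"] by (simp add: add_nonneg_nonneg)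
          finally show ?thesis unfolding e using True False by (simp add: max_absorb1 abs_mult)
        qed
      qed auto
    qed
  qed
qed

text \<open>The reflection z -> -z is orthogonal and preserves the measure, so the integral equals
  its own negative.\<close>

lemma integral_odd_eq_0:
  fixes f :: "'a::euclidean_space \<Rightarrow> 'b::{banach, second_countable_topology}"
  assumes f: "f \<in> borel_measurable borel" and odd: "\<And>z. f (- z) = - f z"
  shows "integral\<^sup>L lebesgue f = 0"
proof -
  have "orthogonal_transformation (uminus :: 'a \<Rightarrow> 'a)"
    using orthogonal_transformation_neg[of "\<lambda>x::'a. x"] by simp
  from integral_orthogonal_transformation[OF this f] have "integral\<^sup>L lborel f = - integral\<^sup>L lborel f"
    by (simp add: odd)
  then have "2 *\<^sub>R integral\<^sup>L lborel f = 0" by (metis add.right_inverse scaleR_2)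
  then show ?thesis using f by (simp add: integral_lebesgue_borel_eq)
qed

text \<open>Subtracting the linear term \<open>p z\<close>, which is odd and therefore does not contribute to the
  truncated integrals, turns the principal value into an absolutely convergent integral.\<close>

lemma pv_integral_tendsto:
  fixes u :: "'a::euclidean_space \<Rightarrow> 'b::{banach, second_countable_topology}"
  assumes \<sigma>: "0 < \<sigma>" and u: "u \<in> borel_measurable lebesgue" and p: "bounded_linear p"
    and G: "integrable lebesgue (\<lambda>z. rkernel \<sigma> z *\<^sub>R (u x + indicat_real (ball 0 r) z *\<^sub>R p z - u (x + z)))"
  shows "((\<lambda>\<epsilon>. LINT y:(- ball x \<epsilon>)|lebesgue.
      (u x - u y) /\<^sub>R (norm (x - y) powr (real DIM('a) + 2 * \<sigma>))) \<longlongrightarrow>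
      (\<integral>z. rkernel \<sigma> z *\<^sub>R (u x + indicat_real (ball 0 r) z *\<^sub>R p z - u (x + z)) \<partial>lebesgue)) (at_right 0)"
    (is "(?I \<longlongrightarrow> integral\<^sup>L lebesgue ?G) _")
proof -
  have pm: "p \<in> borel_measurable borel"
    using p by (intro borel_measurable_continuous_onI linear_continuous_on)
  have eq: "?I \<epsilon> = (\<integral>z. indicat_real (- ball 0 \<epsilon>) z *\<^sub>R ?G z \<partial>lebesgue)" if "0 < \<epsilon>" for \<epsilon>
  proof -
    let ?f = "\<lambda>y. indicat_real (- ball x \<epsilon>) y *\<^sub>R (rkernel \<sigma> (y - x) *\<^sub>R (u x - u y))"
    \<comment> \<open>The truncated linear term. It is supported where \<epsilon> \<le> |z| < r;
      there \<open>p\<close> is bounded and the kernel is integrable. Being odd, it has integral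
      0.\<close>
    let ?H = "\<lambda>z. (indicat_real (- ball 0 \<epsilon>) z * (indicat_real (ball 0 r) z * rkernel \<sigma> z)) *\<^sub>R p z"
    have k: "(\<lambda>y. rkernel \<sigma> (y - x)) \<in> borel_measurable lebesgue"
      using borel_measurable_lebesgue_shift[OF borel_measurable_rkernel_lebesgue, of \<sigma> "- x"] by simp
    have fm: "?f \<in> borel_measurable lebesgue"
      using u k by (intro borel_measurable_scaleR borel_measurable_indicator borel_measurable_diff) auto
    have I: "?I \<epsilon> = integral\<^sup>L lebesgue ?f"
      unfolding set_lebesgue_integral_def rkernel_def by (simp add: norm_minus_commute)
    have fx: "?f (x + z) = indicat_real (- ball 0 \<epsilon>) z *\<^sub>R (rkernel \<sigma> z *\<^sub>R (u x - u (x + z)))" for z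
      by (simp add: indicator_def dist_norm)
    have Hm: "?H \<in> borel_measurable borel"
      using pm by (intro borel_measurable_scaleR borel_measurable_times borel_measurable_indicator borel_measurable_rkernel) auto
    obtain K where K: "\<And>z. norm (p z) \<le> norm z * K" using p bounded_linear.bounded by metis
    have Hi: "integrable lebesgue ?H"
    proof (rule Bochner_Integration.integrable_bound)
      show "integrable lebesgue (\<lambda>z::'a. (\<bar>r\<bar> * \<bar>K\<bar>) * (indicat_real (- ball 0 \<epsilon>) z * rkernel \<sigma> z))"
        by (intro integrable_mult_right integrable_rkernel_tail \<sigma> that)
      show "?H \<in> borel_measurable lebesgue" using Hm by (simp add: measurable_completion)
      show "AE z in lebesgue. norm (?H z) \<le> norm ((\<bar>r\<bar> * \<bar>K\<bar>) * (indicat_real (- ball 0 \<epsilon>) z * rkernel \<sigma> z))"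
      proof (rule AE_I2)
        fix z :: 'a
        show "norm (?H z) \<le> norm ((\<bar>r\<bar> * \<bar>K\<bar>) * (indicat_real (- ball 0 \<epsilon>) z * rkernel \<sigma> z))"
        proof (cases "norm z < r")
          case True
          have "norm (p z) \<le> norm z * \<bar>K\<bar>"
            using K[of z] by (rule order_trans) (simp add: mult_left_mono)
          also have "\<dots> \<le> \<bar>r\<bar> * \<bar>K\<bar>" using True by (intro mult_right_mono) auto
          finally have "rkernel \<sigma> z * norm (p z) \<le> rkernel \<sigma> z * (\<bar>r\<bar> * \<bar>K\<bar>)"
            by (intro mult_left_mono rkernel_nonneg)
          then show ?thesis using True by (simp add: indicator_def abs_mult rkernel_nonneg mult_ac)
        qed simp
      qed
    qed
    have H0: "integral\<^sup>L lebesgue ?H = 0"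
      using Hm by (rule integral_odd_eq_0)
        (simp add: indicator_def linear_neg[OF bounded_linear.linear[OF p]])
    have Gi: "integrable lebesgue (\<lambda>z. indicat_real (- ball 0 \<epsilon>) z *\<^sub>R ?G z)"
      using G by (intro integrable_mult_indicator) auto
    have "?I \<epsilon> = (\<integral>z. ?f (x + z) \<partial>lebesgue)"
      unfolding I using integral_lebesgue_shift[OF fm, of x] by simp
    also have "\<dots> = (\<integral>z. indicat_real (- ball 0 \<epsilon>) z *\<^sub>R ?G z - ?H z \<partial>lebesgue)"
      unfolding fx by (intro Bochner_Integration.integral_cong)
        (auto simp: algebra_simps)
    also have "\<dots> = (\<integral>z. indicat_real (- ball 0 \<epsilon>) z *\<^sub>R ?G z \<partial>lebesgue)"
      using Hi Gi H0 by simp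
    finally show ?thesis .
  qed
  have lim: "((\<lambda>\<epsilon>. \<integral>z. indicat_real (- ball 0 \<epsilon>) z *\<^sub>R ?G z \<partial>lebesgue) \<longlongrightarrow> integral\<^sup>L lebesgue ?G) (at_right 0)"
    unfolding tendsto_at_iff_sequentially o_def
  proof (intro allI impI)
    fix X :: "nat \<Rightarrow> real" assume X: "\<forall>i. X i \<in> {0<..} - {0}" "X \<longlonglongrightarrow> 0"
    show "(\<lambda>n. \<integral>z. indicat_real (- ball 0 (X n)) z *\<^sub>R ?G z \<partial>lebesgue) \<longlonglongrightarrow> integral\<^sup>L lebesgue ?G"
    proof (rule integral_dominated_convergence[where w="\<lambda>z. norm (?G z)"])
      show "?G \<in> borel_measurable lebesgue" using G by (rule borel_measurable_integrable)
      then show "(\<lambda>z. indicat_real (- ball 0 (X n)) z *\<^sub>R ?G z) \<in> borel_measurable lebesgue" for n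
        by (rule borel_measurable_scaleR[OF borel_measurable_indicator, rotated]) simp
      show "AE z in lebesgue. (\<lambda>n. indicat_real (- ball 0 (X n)) z *\<^sub>R ?G z) \<longlonglongrightarrow> ?G z"
      proof (rule AE_I2)
        fix z :: 'a
        show "(\<lambda>n. indicat_real (- ball 0 (X n)) z *\<^sub>R ?G z) \<longlonglongrightarrow> ?G z"
        \<comment> \<open>Away from the origin the truncation is eventually inactive; at the origin
          the integrand is 0 because the kernel is.\<close>
        proof (cases "z = 0")
          case False
          then have "\<forall>\<^sub>F n in sequentially. X n < norm z"
            using X(2) by (intro order_tendstoD) auto
          then have "\<forall>\<^sub>F n in sequentially. indicat_real (- ball 0 (X n)) z *\<^sub>R ?G z = ?G z"
            by (rule eventually_mono) simp
          then show ?thesis by (rule tendsto_eventually)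
        qed simp
      qed
      show "AE z in lebesgue. norm (indicat_real (- ball 0 (X n)) z *\<^sub>R ?G z) \<le> norm (?G z)" for n
        by (intro AE_I2) (simp add: indicator_def)
    qed (rule integrable_norm[OF G])
  qed
  show ?thesis
    by (rule Lim_transform_eventually[OF lim])
      (auto simp: eventually_at_filter eq intro!: always_eventually)
qed

lemma pv_integral_eq:
  fixes u :: "'a::euclidean_space \<Rightarrow> 'b::{banach, second_countable_topology}"
  assumes "0 < \<sigma>" "u \<in> borel_measurable lebesgue" "bounded_linear p"
    and "integrable lebesgue (\<lambda>z. rkernel \<sigma> z *\<^sub>R (u x + indicat_real (ball 0 r) z *\<^sub>R p z - u (x + z)))"
  shows "pv_integral \<sigma> u x =
      (\<integral>z. rkernel \<sigma> z *\<^sub>R (u x + indicat_real (ball 0 r) z *\<^sub>R p z - u (x + z)) \<partial>lebesgue)"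
  unfolding pv_integral_def by (rule tendsto_Lim[OF _ pv_integral_tendsto[OF assms]]) simp

section \<open>Continuity of the principal value integral\<close>

text \<open>On a compact ball the second derivative is bounded by some \<open>C\<close>, so the
  first derivative is \<open>C\<close>-Lipschitz there, and the mean value inequality on the ball of
  radius |z| around \<open>x\<close> gives the remainder. The radius 2r keeps x + z inside that
  compact ball. It matters that \<open>C\<close> is the same for all base points \<open>x\<close>:
  this yields one majorant when \<open>x\<close> varies.\<close>

lemma C2_on_second_order:
  fixes u :: "'a::euclidean_space \<Rightarrow> real"
  assumes S: "open S" and x0: "x0 \<in> S" and u: "C2_on S u"
  obtains u' :: "'a \<Rightarrow> 'a \<Rightarrow>\<^sub>L real" and r C
  where "0 < r" "0 \<le> C" "cball x0 (2 * r) \<subseteq> S"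
    "continuous_on (cball x0 (2 * r)) u" "continuous_on (cball x0 (2 * r)) u'"
    "\<And>x z. x \<in> ball x0 r \<Longrightarrow> norm z < r \<Longrightarrow> \<bar>u x + u' x z - u (x + z)\<bar> \<le> C * (norm z)\<^sup>2"
proof -
  obtain u' :: "'a \<Rightarrow> 'a \<Rightarrow>\<^sub>L real" and u'' :: "'a \<Rightarrow> 'a \<Rightarrow>\<^sub>L ('a \<Rightarrow>\<^sub>L real)"
    where d1: "\<And>x. x \<in> S \<Longrightarrow> (u has_derivative u' x) (at x)"
      and d2: "\<And>x. x \<in> S \<Longrightarrow> (u' has_derivative u'' x) (at x)"
      and c: "continuous_on S u''"
    using u unfolding C2_on_def by blast
  obtain e where e: "0 < e" "cball x0 e \<subseteq> S" using S x0 open_contains_cball by blast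
  define r where "r = e / 2"
  have r: "0 < r" "cball x0 (2 * r) \<subseteq> S" using e by (auto simp: r_def)
  have "compact (u'' ` cball x0 (2 * r))"
    using c r by (intro compact_continuous_image compact_cball) (rule continuous_on_subset)
  then obtain C where C: "\<And>x. x \<in> cball x0 (2 * r) \<Longrightarrow> norm (u'' x) \<le> C"
    using compact_imp_bounded bounded_iff by (metis imageI)
  have C0: "0 \<le> C" using C[of x0] r by (smt (verit) centre_in_cball norm_ge_zero)
  have lip: "norm (u' y - u' x) \<le> C * norm (y - x)" if "x \<in> cball x0 (2 * r)" "y \<in> cball x0 (2 * r)" for x y
  proof (rule differentiable_bound[where S="cball x0 (2 * r)" and f'="\<lambda>x. blinfun_apply (u'' x)"])
    show "(u' has_derivative u'' z) (at z within cball x0 (2 * r))" if "z \<in> cball x0 (2 * r)" for z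
      using d2 that r by (blast intro: has_derivative_at_withinI)
    show "onorm (blinfun_apply (u'' z)) \<le> C" if "z \<in> cball x0 (2 * r)" for z
      using C[OF that] by (simp add: norm_blinfun.rep_eq)
  qed (use that in auto)
  have tay: "\<bar>u x + u' x z - u (x + z)\<bar> \<le> C * (norm z)\<^sup>2" if x: "x \<in> ball x0 r" and z: "norm z < r" for x z
  proof -
    have sub: "cball x (norm z) \<subseteq> cball x0 (2 * r)"
      using x z by (auto simp: cball_subset_cball_iff dist_commute)
    have xx: "x \<in> cball x0 (2 * r)" using x r by auto
    have "norm (u (x + z) - u x - u' x (x + z - x)) \<le> norm (x + z - x) * (C * norm z)"
    proof (rule differentiable_bound_linearization[where S="cball x (norm z)" and f'="\<lambda>y. blinfun_apply (u' y)"])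
      show "x + t *\<^sub>R (x + z - x) \<in> cball x (norm z)" if "t \<in> {0..1}" for t
        using that by (simp add: dist_norm mult_left_le_one_le)
      show "(u has_derivative u' y) (at y within cball x (norm z))" if "y \<in> cball x (norm z)" for y
        using d1 that r sub by (blast intro: has_derivative_at_withinI)
      show "onorm (blinfun_apply (u' y) - blinfun_apply (u' x)) \<le> C * norm z" if y: "y \<in> cball x (norm z)" for y
      proof -
        have "norm (u' y - u' x) \<le> C * norm (y - x)" using lip[OF xx] sub y by blast
        also have "\<dots> \<le> C * norm z" using y C0 by (intro mult_left_mono) (auto simp: dist_norm norm_minus_commute)
        finally show ?thesis by (simp add: norm_blinfun.rep_eq fun_diff_def blinfun.diff_left[abs_def])
      qed
    qed auto
    then show ?thesis by (simp add: power2_eq_square abs_minus_commute algebra_simps)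
  qed
  have "continuous_on (cball x0 (2 * r)) u" "continuous_on (cball x0 (2 * r)) u'"
    using d1 d2 r by (meson has_derivative_continuous continuous_at_imp_continuous_on subsetD)+
  then show thesis using that[of r C u'] r C0 tay by blast
qed

text \<open>The weight is measurable and positive, so dividing the integrable weighted function by
  it recovers \<open>u\<close>.\<close>

lemma L1_weighted_measurable:
  assumes "u \<in> L1_weighted \<sigma>"
  shows "u \<in> borel_measurable lebesgue"
proof -
  let ?w = "\<lambda>x::'a. (1 + norm x) powr (- (real DIM('a) + 2 * \<sigma>))"
  have "(\<lambda>x. ?w x * u x) \<in> borel_measurable lebesgue"
    using assms by (auto simp: L1_weighted_def)
  moreover have "?w \<in> borel_measurable lebesgue"
    by (rule measurable_completion) (simp, measurable)
  ultimately have "(\<lambda>x. (?w x * u x) / ?w x) \<in> borel_measurable lebesgue" by (rule borel_measurable_divide)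
  moreover have "(?w x * u x) / ?w x = u x" for x
    by (simp add: add_nonneg_eq_0_iff)
  ultimately show ?thesis by (simp del: minus_add_distrib)
qed

text \<open>From |y - x| \<ge> r follows 1 + |y| \<le> 1 + R + |y - x| \<le> ((1 + R)/r + 1) |y -
  x|. The constant depends on \<open>x\<close> only through the bound \<open>R\<close>, so it can be
  used for all \<open>x\<close> in a ball at once.\<close>

lemma rkernel_le_weight:
  fixes x y :: "'a::euclidean_space"
  assumes "0 < \<sigma>" "0 < r" "norm x \<le> R" "r \<le> norm (y - x)"
  shows "rkernel \<sigma> (y - x) \<le> ((1 + R) / r + 1) powr (real DIM('a) + 2 * \<sigma>) * (1 + norm y) powr (- (real DIM('a) + 2 * \<sigma>))"
proof -
  let ?a = "real DIM('a) + 2 * \<sigma>"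
  have R: "0 \<le> R" using assms norm_ge_zero order_trans by blast
  have "norm y \<le> norm x + norm (y - x)" using norm_triangle_ineq[of x "y - x"] by simp
  moreover have "(1 + R) * r \<le> (1 + R) * norm (y - x)"
    using assms R by (intro mult_left_mono) auto
  then have "1 + R \<le> (1 + R) / r * norm (y - x)"
    using assms(2) by (simp add: pos_le_divide_eq)
  ultimately have "1 + norm y \<le> ((1 + R) / r + 1) * norm (y - x)"
    using assms by (simp add: algebra_simps)
  then have "(1 + norm y) powr ?a \<le> (((1 + R) / r + 1) * norm (y - x)) powr ?a"
    using assms by (intro powr_mono2) auto
  also have "\<dots> = ((1 + R) / r + 1) powr ?a * norm (y - x) powr ?a"
    using assms R by (intro powr_mult)
  finally have *: "(1 + norm y) powr ?a \<le> ((1 + R) / r + 1) powr ?a * norm (y - x) powr ?a" .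
  have p: "0 < (1 + norm y) powr ?a" "0 < norm (y - x) powr ?a"
    using assms by (auto simp: add_nonneg_eq_0_iff)
  show ?thesis unfolding rkernel_def powr_minus[of _ ?a]
    using * p by (simp add: field_simps)
qed

lemma L1_weighted_far_integrable:
  fixes u :: "'a::euclidean_space \<Rightarrow> real"
  assumes \<sigma>: "0 < \<sigma>" and u: "u \<in> L1_weighted \<sigma>" and r: "0 < r"
  shows "integrable lebesgue (\<lambda>y. indicat_real (- ball x r) y * (rkernel \<sigma> (y - x) * u y))"
    and "(\<lambda>y. indicat_real (- ball x r) y * (rkernel \<sigma> (y - x) * u y)) \<in> borel_measurable lebesgue"
proof -
  let ?w = "\<lambda>y::'a. (1 + norm y) powr (- (real DIM('a) + 2 * \<sigma>))"
  let ?K = "((1 + norm x) / r + 1) powr (real DIM('a) + 2 * \<sigma>)"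
  have k: "(\<lambda>y. rkernel \<sigma> (y - x)) \<in> borel_measurable lebesgue"
    using borel_measurable_lebesgue_shift[OF borel_measurable_rkernel_lebesgue, of \<sigma> "- x"] by simp
  show m: "(\<lambda>y. indicat_real (- ball x r) y * (rkernel \<sigma> (y - x) * u y)) \<in> borel_measurable lebesgue"
    using k L1_weighted_measurable[OF u]
    by (intro borel_measurable_times borel_measurable_indicator) auto
  show "integrable lebesgue (\<lambda>y. indicat_real (- ball x r) y * (rkernel \<sigma> (y - x) * u y))"
  proof (rule Bochner_Integration.integrable_bound[OF _ m])
    show "integrable lebesgue (\<lambda>y. ?K * (?w y * u y))"
      using u by (intro integrable_mult_right) (simp add: L1_weighted_def)
    show "AE y in lebesgue. norm (indicat_real (- ball x r) y * (rkernel \<sigma> (y - x) * u y)) \<le> norm (?K * (?w y * u y))"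
    proof (rule AE_I2)
      fix y
      show "norm (indicat_real (- ball x r) y * (rkernel \<sigma> (y - x) * u y)) \<le> norm (?K * (?w y * u y))"
      proof (cases "y \<in> ball x r")
        case False
        then have "r \<le> norm (y - x)" by (simp add: dist_norm norm_minus_commute)
        then have "rkernel \<sigma> (y - x) \<le> ?K * ?w y"
          by (rule rkernel_le_weight[OF \<sigma> r order_refl])
        then have "rkernel \<sigma> (y - x) * \<bar>u y\<bar> \<le> ?K * ?w y * \<bar>u y\<bar>"
          by (rule mult_right_mono) simp
        then show ?thesis using False by (simp add: abs_mult rkernel_nonneg mult.assoc del: minus_add_distrib)
      qed simp
    qed
  qed
qed

text \<open>The corrected integrand is split at one radius \<open>r\<close> into a Taylor remainder
  \<open>N\<close> near the singularity, the constant value u x times the kernel tail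
  \<open>T\<close>, and a far part \<open>F\<close>. The resulting formula for \<open>L\<close>
  holds for every \<open>x\<close> in the ball around \<open>x0\<close>, and dominated convergence
  applied to \<open>N\<close> and to \<open>F\<close> makes it continuous.\<close>

lemma pv_integral_C2_aux:
  fixes u :: "'a::euclidean_space \<Rightarrow> real"
  assumes \<sigma>: "0 < \<sigma>" "\<sigma> < 1" and S: "open S" "x0 \<in> S"
    and u: "C2_on S u" "u \<in> L1_weighted \<sigma>"
  obtains L r where "0 < r" "isCont L x0"
    "\<And>x. x \<in> ball x0 r \<Longrightarrow> ((\<lambda>\<epsilon>. LINT y:(- ball x \<epsilon>)|lebesgue.
      (u x - u y) /\<^sub>R (norm (x - y) powr (real DIM('a) + 2 * \<sigma>))) \<longlongrightarrow> L x) (at_right 0)"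
proof -
  obtain u' :: "'a \<Rightarrow> 'a \<Rightarrow>\<^sub>L real" and r C where r: "0 < r" and C: "0 \<le> C"
    and cu: "continuous_on (cball x0 (2 * r)) u" and cu': "continuous_on (cball x0 (2 * r)) u'"
    and tay: "\<And>x z. x \<in> ball x0 r \<Longrightarrow> norm z < r \<Longrightarrow> \<bar>u x + u' x z - u (x + z)\<bar> \<le> C * (norm z)\<^sup>2"
    using C2_on_second_order[OF S u(1)] by metis
  let ?k = "rkernel \<sigma> :: 'a \<Rightarrow> real"
  let ?w = "\<lambda>y::'a. (1 + norm y) powr (- (real DIM('a) + 2 * \<sigma>))"
  define N where "N x z = indicat_real (ball 0 r) z * (?k z * (u x + u' x z - u (x + z)))" for x z
  \<comment> \<open>The far part is kept in the variable \<open>y\<close>, not in z = y - x: only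
    the kernel and the cutoff then move with \<open>x\<close>, while \<open>u\<close>, which is
    merely measurable far away, stays fixed.\<close>
  define F where "F x y = indicat_real (- ball x r) y * (?k (y - x) * u y)" for x y
  define T where "T z = indicat_real (- ball 0 r) z * ?k z" for z
  define L where "L x = integral\<^sup>L lebesgue (N x) + (u x * integral\<^sup>L lebesgue T - integral\<^sup>L lebesgue (F x))" for x
  have um: "u \<in> borel_measurable lebesgue" using u by (intro L1_weighted_measurable)
  have u'm: "(\<lambda>z. u' x z) \<in> borel_measurable lebesgue" for x
    by (rule measurable_completion) (simp, intro borel_measurable_continuous_onI blinfun.continuous_on continuous_intros)
  have Nm: "N x \<in> borel_measurable lebesgue" for x
    unfolding N_def using borel_measurable_lebesgue_shift[OF um, of x] u'm[of x]
    by (intro borel_measurable_times borel_measurable_indicator borel_measurable_diff borel_measurable_add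
        borel_measurable_rkernel_lebesgue) auto
  have near: "integrable lebesgue (\<lambda>z::'a. C * (indicat_real (ball 0 r) z * ((norm z)\<^sup>2 * ?k z)))"
    by (intro integrable_mult_right integrable_rkernel_near \<sigma> r)
  have Nb: "norm (N x z) \<le> C * (indicat_real (ball 0 r) z * ((norm z)\<^sup>2 * ?k z))" if "x \<in> ball x0 r" for x z
  proof (cases "z \<in> ball 0 r")
    case True
    then have "?k z * \<bar>u x + u' x z - u (x + z)\<bar> \<le> ?k z * (C * (norm z)\<^sup>2)"
      using tay[OF that] by (intro mult_left_mono rkernel_nonneg) auto
    then show ?thesis using True by (simp add: N_def abs_mult rkernel_nonneg mult_ac)
  qed (simp add: N_def)
  have Ni: "integrable lebesgue (N x)" if "x \<in> ball x0 r" for x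
  proof (rule Bochner_Integration.integrable_bound[OF near Nm])
    show "AE z in lebesgue. norm (N x z) \<le> norm (C * (indicat_real (ball 0 r) z * ((norm z)\<^sup>2 * ?k z)))"
      using Nb[OF that] by (intro AE_I2) (smt (verit) real_norm_def)
  qed
  have Ti: "integrable lebesgue T" unfolding T_def by (intro integrable_rkernel_tail \<sigma> r)
  have Fi: "integrable lebesgue (F x)" and Fm: "F x \<in> borel_measurable lebesgue" for x
    unfolding F_def by (intro L1_weighted_far_integrable \<sigma> r u)+
  have Fs: "integrable lebesgue (\<lambda>z. F x (x + z))" "(\<integral>z. F x (x + z) \<partial>lebesgue) = integral\<^sup>L lebesgue (F x)" for x
    using integrable_lebesgue_shift_iff[OF Fm] Fi integral_lebesgue_shift[OF Fm] by auto
  have split: "?k z *\<^sub>R (u x + indicat_real (ball 0 r) z *\<^sub>R u' x z - u (x + z))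
      = N x z + (u x * T z - F x (x + z))" for x z
    by (auto simp: N_def T_def F_def indicator_def dist_norm algebra_simps)
  have lim: "((\<lambda>\<epsilon>. LINT y:(- ball x \<epsilon>)|lebesgue.
      (u x - u y) /\<^sub>R (norm (x - y) powr (real DIM('a) + 2 * \<sigma>))) \<longlongrightarrow> L x) (at_right 0)"
    if x: "x \<in> ball x0 r" for x
  proof -
    have G: "integrable lebesgue (\<lambda>z. ?k z *\<^sub>R (u x + indicat_real (ball 0 r) z *\<^sub>R u' x z - u (x + z)))"
      unfolding split using Ni[OF x] Ti Fs(1)[of x] by simp
    have "(\<integral>z. ?k z *\<^sub>R (u x + indicat_real (ball 0 r) z *\<^sub>R u' x z - u (x + z)) \<partial>lebesgue) = L x"
      unfolding split L_def using Ni[OF x] Ti Fs[of x] by simp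
    then show ?thesis
      using pv_integral_tendsto[OF \<sigma>(1) um blinfun.bounded_linear_right G] by simp
  qed
  have cont: "(L \<longlongrightarrow> L x0) (at x0 within ball x0 r)"
    unfolding tendsto_at_iff_sequentially o_def
  proof (intro allI impI)
    fix X assume X0: "\<forall>i. X i \<in> ball x0 r - {x0}" and X: "X \<longlonglongrightarrow> x0"
    have Xi: "X i \<in> ball x0 r" for i using X0 by blast
    have uX: "(\<lambda>n. u (X n + z)) \<longlonglongrightarrow> u (x0 + z)" if "norm z < r" for z
    proof (rule continuous_on_tendsto_compose[OF cu])
      show "(\<lambda>n. X n + z) \<longlonglongrightarrow> x0 + z" by (intro tendsto_intros X)
      show "x0 + z \<in> cball x0 (2 * r)" using that r by (simp add: dist_norm)
      have "X n + z \<in> cball x0 (2 * r)" for n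
      proof -
        have "dist x0 (X n + z) \<le> dist x0 (X n) + norm z"
          using dist_triangle[of x0 "X n + z" "X n"] by (simp add: dist_norm)
        then show ?thesis using that Xi[of n] by simp
      qed
      then show "\<forall>\<^sub>F n in sequentially. X n + z \<in> cball x0 (2 * r)" by simp
    qed
    have Xc: "X i \<in> cball x0 (2 * r)" for i using Xi[of i] r by simp
    have u'X: "(\<lambda>n. u' (X n)) \<longlonglongrightarrow> u' x0"
      using r Xc by (intro continuous_on_tendsto_compose[OF cu' X]) auto
    have 1: "(\<lambda>n. integral\<^sup>L lebesgue (N (X n))) \<longlonglongrightarrow> integral\<^sup>L lebesgue (N x0)"
    proof (rule integral_dominated_convergence[OF Nm Nm near])
      show "AE z in lebesgue. (\<lambda>n. N (X n) z) \<longlonglongrightarrow> N x0 z"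
      proof (rule AE_I2)
        fix z
        show "(\<lambda>n. N (X n) z) \<longlonglongrightarrow> N x0 z"
        proof (cases "z \<in> ball 0 r")
          case True
          then show ?thesis unfolding N_def using uX[of 0] uX[of z] r
            by (intro tendsto_intros u'X) auto
        qed (simp add: N_def)
      qed
      show "AE z in lebesgue. norm (N (X n) z) \<le> C * (indicat_real (ball 0 r) z * ((norm z)\<^sup>2 * ?k z))" for n
        using Nb[OF Xi] by simp
    qed
    \<comment> \<open>All \<open>X n\<close> lie in \<open>ball x0 r\<close>, so norm x0 + r bounds
      their norms and the majorant does not depend on \<open>n\<close>.\<close>
    let ?K = "((1 + (norm x0 + r)) / r + 1) powr (real DIM('a) + 2 * \<sigma>)"
    have 2: "(\<lambda>n. integral\<^sup>L lebesgue (F (X n))) \<longlonglongrightarrow> integral\<^sup>L lebesgue (F x0)"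
    proof (rule integral_dominated_convergence[OF Fm Fm])
      show "integrable lebesgue (\<lambda>y. ?K * norm (?w y * u y))"
        using u by (intro integrable_mult_right integrable_norm) (simp add: L1_weighted_def)
      show "AE y in lebesgue. norm (F (X n) y) \<le> ?K * norm (?w y * u y)" for n
      proof (rule AE_I2)
        fix y
        have nX: "norm (X n) \<le> norm x0 + r"
          using Xi[of n] norm_triangle_ineq2[of "X n" x0] by (simp add: dist_norm norm_minus_commute)
        show "norm (F (X n) y) \<le> ?K * norm (?w y * u y)"
        proof (cases "y \<in> ball (X n) r")
          case False
          then have "r \<le> norm (y - X n)" by (simp add: dist_norm norm_minus_commute)
          then have "?k (y - X n) \<le> ?K * ?w y"
            by (rule rkernel_le_weight[OF \<sigma>(1) r nX])
          then have "?k (y - X n) * \<bar>u y\<bar> \<le> ?K * ?w y * \<bar>u y\<bar>"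
            by (rule mult_right_mono) simp
          then show ?thesis using False
            by (simp add: F_def abs_mult rkernel_nonneg mult.assoc del: minus_add_distrib)
        qed (simp add: F_def)
      qed
      \<comment> \<open>The cutoff of the far part jumps across this sphere, so pointwise
        convergence is shown only off it.\<close>
      have "sphere x0 r \<in> null_sets lebesgue"
        using negligible_sphere negligible_iff_null_sets by blast
      then have "AE y in lebesgue. y \<notin> sphere x0 r" by (rule AE_not_in)
      then show "AE y in lebesgue. (\<lambda>n. F (X n) y) \<longlonglongrightarrow> F x0 y"
      proof eventually_elim
        case (elim y)
        have d: "(\<lambda>n. dist (X n) y) \<longlonglongrightarrow> dist x0 y" by (intro tendsto_intros X)
        show ?case
        proof (cases "dist x0 y < r")
          case True
          then have "\<forall>\<^sub>F n in sequentially. dist (X n) y < r" using order_tendstoD(2)[OF d] by blast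
          then have "\<forall>\<^sub>F n in sequentially. F (X n) y = F x0 y"
            by (rule eventually_mono) (use True in \<open>simp add: F_def\<close>)
          then show ?thesis by (rule tendsto_eventually)
        next
          case False
          then have gt: "r < dist x0 y" using elim by simp
          then have "\<forall>\<^sub>F n in sequentially. r < dist (X n) y" using order_tendstoD(1)[OF d] by blast
          then have ev: "\<forall>\<^sub>F n in sequentially. ?k (y - X n) * u y = F (X n) y"
            by (rule eventually_mono) (simp add: F_def)
          have ne: "norm (y - x0) \<noteq> 0" using gt r by auto
          have "(\<lambda>n. ?k (y - X n) * u y) \<longlonglongrightarrow> ?k (y - x0) * u y"
            unfolding rkernel_def using ne by (intro tendsto_intros X) auto
          moreover have "?k (y - x0) * u y = F x0 y" using gt by (simp add: F_def)
          ultimately show ?thesis using ev by (metis Lim_transform_eventually)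
        qed
      qed
    qed
    have "(\<lambda>n. u (X n)) \<longlonglongrightarrow> u x0" using uX[of 0] r by simp
    then show "(\<lambda>n. L (X n)) \<longlonglongrightarrow> L x0"
      unfolding L_def by (intro tendsto_intros 1 2)
  qed
  have "isCont L x0" using cont r by (simp add: isCont_def at_within_open[of x0 "ball x0 r"])
  then show thesis using that r lim by blast
qed

text \<open>Uniqueness of limits identifies the \<open>Lim\<close> in \<open>pv_integral\<close>
  with the function \<open>L\<close> of the auxiliary lemma on a whole ball, so convergence and
  continuity both carry over.\<close>

lemma pv_integral_C2:
  fixes u :: "'a::euclidean_space \<Rightarrow> real"
  assumes "0 < \<sigma>" "\<sigma> < 1" "open S" "x0 \<in> S" "C2_on S u" "u \<in> L1_weighted \<sigma>"
  shows "((\<lambda>\<epsilon>. LINT y:(- ball x0 \<epsilon>)|lebesgue.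
      (u x0 - u y) /\<^sub>R (norm (x0 - y) powr (real DIM('a) + 2 * \<sigma>))) \<longlongrightarrow> pv_integral \<sigma> u x0) (at_right 0)"
    and "isCont (pv_integral \<sigma> u) x0"
proof -
  obtain r L where L: "0 < r" "isCont L x0"
    "\<And>x. x \<in> ball x0 r \<Longrightarrow> ((\<lambda>\<epsilon>. LINT y:(- ball x \<epsilon>)|lebesgue.
      (u x - u y) /\<^sub>R (norm (x - y) powr (real DIM('a) + 2 * \<sigma>))) \<longlongrightarrow> L x) (at_right 0)"
    by (rule pv_integral_C2_aux[OF assms]) blast
  have eq: "pv_integral \<sigma> u x = L x" if "x \<in> ball x0 r" for x
    unfolding pv_integral_def using L(3)[OF that] by (intro tendsto_Lim) auto
  show "((\<lambda>\<epsilon>. LINT y:(- ball x0 \<epsilon>)|lebesgue.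
      (u x0 - u y) /\<^sub>R (norm (x0 - y) powr (real DIM('a) + 2 * \<sigma>))) \<longlongrightarrow> pv_integral \<sigma> u x0) (at_right 0)"
    using L(3)[of x0] eq[of x0] L(1) by simp
  have "\<forall>\<^sub>F x in nhds x0. pv_integral \<sigma> u x = L x"
    using eq L(1) by (intro eventually_nhds_in_open[THEN eventually_mono, of "ball x0 r"]) auto
  then show "isCont (pv_integral \<sigma> u) x0" using L(2) isCont_cong by blast
qed

section \<open>The normalizing constant\<close>

text \<open>A nonempty open set is not a null set.\<close>

lemma AE_lebesgue_open_ex:
  fixes S :: "'a::euclidean_space set"
  assumes "AE x in lebesgue. P x" "open S" "S \<noteq> {}"
  shows "\<exists>x\<in>S. P x"
proof (rule ccontr)
  assume "\<not> ?thesis"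
  then have "S \<subseteq> {x. \<not> P x}" by blast
  moreover have "{x. \<not> P x} \<in> null_sets lebesgue"
    using assms(1) by (simp add: AE_iff_null_sets[symmetric] completion.complete2 eventually_ae_filter)
      (metis (no_types, lifting) completion.complete2 mem_Collect_eq subsetI)
  ultimately have "negligible S" using negligible_iff_null_sets negligible_subset by blast
  then show False using assms open_not_negligible by blast
qed

lemma integral_lborel_scaleR:
  fixes f :: "'a::euclidean_space \<Rightarrow> real"
  assumes f: "f \<in> borel_measurable borel" and c: "0 < c"
  shows "integral\<^sup>L lborel f = c ^ DIM('a) * (\<integral>z. f (c *\<^sub>R z) \<partial>lborel)"
proof -
  let ?T = "\<lambda>x::'a. 0 + c *\<^sub>R x"
  have T: "?T \<in> lborel \<rightarrow>\<^sub>M borel" by simp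
  have eq: "lborel = density (distr lborel borel ?T) (\<lambda>_. ennreal (c ^ DIM('a)))"
    using lborel_affine[of c "0::'a"] c by (simp add: abs_of_pos)
  have "integral\<^sup>L lborel f = integral\<^sup>L (density (distr lborel borel ?T) (\<lambda>_. ennreal (c ^ DIM('a)))) f"
    by (subst eq) (rule refl)
  also have "\<dots> = (\<integral>z. c ^ DIM('a) *\<^sub>R f z \<partial>distr lborel borel ?T)"
    using f c by (intro integral_density) auto
  also have "\<dots> = (\<integral>z. c ^ DIM('a) *\<^sub>R f (?T z) \<partial>lborel)"
    using f by (intro integral_distr[OF T]) auto
  finally show ?thesis by simp
qed

text \<open>The exponential factor in the complex Taylor estimate is 1, because the argument is
  purely imaginary.\<close>

lemma norm_cis_Taylor: "norm (1 + of_real t * \<i> - cis t) \<le> t\<^sup>2"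
proof -
  have "norm (exp (\<i> * of_real t) - (\<Sum>k\<le>1. (\<i> * of_real t) ^ k / fact k))
      \<le> exp \<bar>Re (\<i> * of_real t)\<bar> * norm (\<i> * of_real t) ^ Suc 1 / fact 1"
    by (rule Taylor_exp)
  then have "norm (cis t - (1 + of_real t * \<i>)) \<le> t\<^sup>2"
    by (simp add: cis_conv_exp norm_mult power2_eq_square mult.commute)
  then show ?thesis by (simp add: norm_minus_commute)
qed

text \<open>Factoring cis (\<xi> \<bullet> x) out of the integrand leaves a function
  \<open>D\<close> independent of \<open>x\<close>. Its imaginary part is odd and integrates to 0;
  its real part is the stated integrand.\<close>

lemma pv_integral_cis:
  fixes \<xi> x :: "'a::euclidean_space"
  assumes \<sigma>: "0 < \<sigma>" "\<sigma> < 1"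
  shows "pv_integral \<sigma> (\<lambda>y. cis (\<xi> \<bullet> y)) x
      = (\<integral>z. (1 - cos (\<xi> \<bullet> z)) * rkernel \<sigma> z \<partial>lebesgue) *\<^sub>R cis (\<xi> \<bullet> x)" (is ?eq)
    and "integrable lebesgue (\<lambda>z. (1 - cos (\<xi> \<bullet> z)) * rkernel \<sigma> z)" (is ?int)
proof -
  let ?k = "rkernel \<sigma> :: 'a \<Rightarrow> real"
  define D where "D z = ?k z *\<^sub>R (1 + of_real (indicat_real (ball 0 1) z * (\<xi> \<bullet> z)) * \<i> - cis (\<xi> \<bullet> z))" for z
  have cis: "(\<lambda>z. cis (\<xi> \<bullet> z)) \<in> borel_measurable borel"
    by (intro borel_measurable_continuous_onI continuous_intros)
  have ind: "indicat_real (ball (0::'a) 1) \<in> borel_measurable borel"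
    by (intro borel_measurable_indicator) simp
  have Dm: "D \<in> borel_measurable borel"
    unfolding D_def using ind cis by measurable
  have "integrable lebesgue (\<lambda>z::'a. (norm \<xi>)\<^sup>2 * (indicat_real (ball 0 1) z * ((norm z)\<^sup>2 * ?k z))
      + 2 * (indicat_real (- ball 0 1) z * ?k z))"
    using \<sigma> by (intro Bochner_Integration.integrable_add integrable_mult_right integrable_rkernel_near integrable_rkernel_tail) auto
  then have Di: "integrable lebesgue D"
  proof (rule Bochner_Integration.integrable_bound)
    show "D \<in> borel_measurable lebesgue" using Dm by (simp add: measurable_completion)
    have "norm (D z) \<le> (norm \<xi>)\<^sup>2 * (indicat_real (ball 0 1) z * ((norm z)\<^sup>2 * ?k z))
      + 2 * (indicat_real (- ball 0 1) z * ?k z)" for z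
    proof (cases "z \<in> ball 0 1")
      case True
      have "norm (1 + of_real (\<xi> \<bullet> z) * \<i> - cis (\<xi> \<bullet> z)) \<le> (\<xi> \<bullet> z)\<^sup>2" by (rule norm_cis_Taylor)
      also have "\<dots> \<le> (norm \<xi> * norm z)\<^sup>2" by (rule abs_le_square_iff[THEN iffD1]) (simp add: Cauchy_Schwarz_ineq2 abs_mult)
      finally have "?k z * norm (1 + of_real (\<xi> \<bullet> z) * \<i> - cis (\<xi> \<bullet> z)) \<le> ?k z * (norm \<xi> * norm z)\<^sup>2"
        by (intro mult_left_mono rkernel_nonneg)
      then show ?thesis using True by (simp add: D_def rkernel_nonneg power_mult_distrib mult_ac)
    next
      case False
      have "norm (1 - cis (\<xi> \<bullet> z)) \<le> 2" using norm_triangle_ineq4[of 1 "cis (\<xi> \<bullet> z)"] by simp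
      then have "?k z * norm (1 - cis (\<xi> \<bullet> z)) \<le> ?k z * 2" by (intro mult_left_mono rkernel_nonneg)
      then show ?thesis using False by (simp add: D_def rkernel_nonneg)
    qed
    then show "AE z in lebesgue. norm (D z) \<le> norm ((norm \<xi>)\<^sup>2 * (indicat_real (ball 0 1) z * ((norm z)\<^sup>2 * ?k z))
      + 2 * (indicat_real (- ball 0 1) z * ?k z))"
      by (intro AE_I2) (smt (verit) real_norm_def)
  qed
  have Re: "Re (D z) = (1 - cos (\<xi> \<bullet> z)) * ?k z" for z by (simp add: D_def)
  show ?int using integrable_Re[OF Di] by (simp add: Re)
  have "integral\<^sup>L lebesgue (\<lambda>z. Im (D z)) = 0"
  proof (rule integral_odd_eq_0)
    show "(\<lambda>z. Im (D z)) \<in> borel_measurable borel" using Dm by measurable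
    show "Im (D (- z)) = - Im (D z)" for z by (simp add: D_def indicator_def algebra_simps)
  qed
  then have D: "integral\<^sup>L lebesgue D = of_real (\<integral>z. (1 - cos (\<xi> \<bullet> z)) * ?k z \<partial>lebesgue)"
    using integral_Re[OF Di] integral_Im[OF Di] by (intro complex_eqI) (simp_all add: Re)
  \<comment> \<open>The derivative of the plane wave at \<open>x\<close>.\<close>
  let ?p = "\<lambda>z. (\<xi> \<bullet> z) *\<^sub>R (\<i> * cis (\<xi> \<bullet> x))"
  have G: "?k z *\<^sub>R (cis (\<xi> \<bullet> x) + indicat_real (ball 0 1) z *\<^sub>R ?p z - cis (\<xi> \<bullet> (x + z)))
      = cis (\<xi> \<bullet> x) * D z" for z
    by (simp add: D_def inner_add_right scaleR_conv_of_real algebra_simps flip: cis_mult)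
  have "pv_integral \<sigma> (\<lambda>y. cis (\<xi> \<bullet> y)) x
      = (\<integral>z. ?k z *\<^sub>R (cis (\<xi> \<bullet> x) + indicat_real (ball 0 1) z *\<^sub>R ?p z - cis (\<xi> \<bullet> (x + z))) \<partial>lebesgue)"
  proof (rule pv_integral_eq[OF \<sigma>(1)])
    show "(\<lambda>y. cis (\<xi> \<bullet> y)) \<in> borel_measurable lebesgue" using cis by (simp add: measurable_completion)
    show "bounded_linear ?p"
      by (rule bounded_linear_scaleR_left[THEN bounded_linear_compose, OF bounded_linear_inner_right])
    show "integrable lebesgue (\<lambda>z. ?k z *\<^sub>R (cis (\<xi> \<bullet> x) + indicat_real (ball 0 1) z *\<^sub>R ?p z - cis (\<xi> \<bullet> (x + z))))"
      unfolding G using Di by simp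
  qed
  then show ?eq unfolding G using D by (simp add: scaleR_conv_of_real mult.commute)
qed

text \<open>An orthogonal map taking s e to \<xi>, with s = |\<xi>|, reduces to the direction
  \<open>e\<close>. Dilation by \<open>s\<close> then gives s^(N + 2 \<sigma>) from the homogeneity
  of the kernel and s^(-N) from the volume. For \<xi> = 0 both sides vanish.\<close>

lemma integral_one_minus_cos_rkernel:
  fixes \<xi> e :: "real ^ 'n"
  assumes \<sigma>: "0 < \<sigma>" and e: "norm e = 1"
  shows "(\<integral>z. (1 - cos (\<xi> \<bullet> z)) * rkernel \<sigma> z \<partial>lebesgue)
      = norm \<xi> powr (2 * \<sigma>) * (\<integral>z. (1 - cos (e \<bullet> z)) * rkernel \<sigma> z \<partial>lebesgue)"
proof (cases "\<xi> = 0")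
  case False
  define s where "s = norm \<xi>"
  have s: "0 < s" using False by (simp add: s_def)
  define h where "h \<eta> z = (1 - cos (\<eta> \<bullet> z)) * rkernel \<sigma> z" for \<eta> z :: "real ^ 'n"
  have hm: "h \<eta> \<in> borel_measurable borel" for \<eta>
    unfolding h_def by (intro borel_measurable_times borel_measurable_rkernel borel_measurable_continuous_onI continuous_intros)
  obtain Q :: "real ^ 'n \<Rightarrow> real ^ 'n" where Q: "orthogonal_transformation Q" "Q (s *\<^sub>R e) = \<xi>"
    using orthogonal_transformation_exists[of "s *\<^sub>R e" \<xi>] e by (auto simp: s_def)
  have hQ: "h \<xi> (Q z) = h (s *\<^sub>R e) z" for z
  proof -
    have "\<xi> \<bullet> Q z = (s *\<^sub>R e) \<bullet> z"
      using Q unfolding orthogonal_transformation_def by metis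
    then show ?thesis
      using Q(1) by (simp add: h_def rkernel_def orthogonal_transformation_norm)
  qed
  have hs: "h (s *\<^sub>R e) z = s powr (real CARD('n) + 2 * \<sigma>) * h e (s *\<^sub>R z)" for z
    using s by (simp add: h_def rkernel_def powr_mult)
  have "integral\<^sup>L lborel (h \<xi>) = (\<integral>z. h \<xi> (Q z) \<partial>lborel)"
    using integral_orthogonal_transformation[OF Q(1) hm] by simp
  also have "\<dots> = s powr (real CARD('n) + 2 * \<sigma>) * (\<integral>z. h e (s *\<^sub>R z) \<partial>lborel)"
    unfolding hQ hs by simp
  also have "\<dots> = s powr (2 * \<sigma>) * (s ^ CARD('n) * (\<integral>z. h e (s *\<^sub>R z) \<partial>lborel))"
    using s by (simp add: powr_add powr_realpow)
  also have "s ^ CARD('n) * (\<integral>z. h e (s *\<^sub>R z) \<partial>lborel) = integral\<^sup>L lborel (h e)"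
    using integral_lborel_scaleR[OF hm s, of e] by simp
  finally have "integral\<^sup>L lebesgue (h \<xi>) = s powr (2 * \<sigma>) * integral\<^sup>L lebesgue (h e)"
    using hm by (simp add: integral_lebesgue_borel_eq)
  then show ?thesis by (simp add: h_def[abs_def] s_def)
qed simp

text \<open>The integrand is nonnegative, and it is positive on the open slab 0 < e \<bullet> z < 1,
  where the cosine is below 1.\<close>

lemma integral_one_minus_cos_rkernel_pos:
  fixes e :: "'a::euclidean_space"
  assumes \<sigma>: "0 < \<sigma>" "\<sigma> < 1" and e: "norm e = 1"
  shows "0 < (\<integral>z. (1 - cos (e \<bullet> z)) * rkernel \<sigma> z \<partial>lebesgue)"
proof -
  let ?h = "\<lambda>z. (1 - cos (e \<bullet> z)) * rkernel \<sigma> z"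
  have nn: "0 \<le> ?h z" for z by (simp add: rkernel_nonneg)
  have "integral\<^sup>L lebesgue ?h \<noteq> 0"
  proof
    assume "integral\<^sup>L lebesgue ?h = 0"
    then have "AE z in lebesgue. ?h z = 0"
      using integral_nonneg_eq_0_iff_AE[OF pv_integral_cis(2)[OF \<sigma>, of e]] nn by auto
    moreover have "open {z. 0 < e \<bullet> z \<and> e \<bullet> z < 1}"
      by (intro open_Collect_conj open_Collect_less continuous_intros)
    moreover have "(1/2) *\<^sub>R e \<in> {z. 0 < e \<bullet> z \<and> e \<bullet> z < 1}" using e by (simp add: dot_square_norm)
    ultimately obtain z where z: "0 < e \<bullet> z" "e \<bullet> z < 1" "?h z = 0"
      using AE_lebesgue_open_ex by blast
    then have "z \<noteq> 0" by auto
    then have "cos (e \<bullet> z) = 1" using z(3) rkernel_pos[of z \<sigma>] by simp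
    moreover have "cos (e \<bullet> z) < cos 0" using z pi_gt3 by (intro cos_monotone_0_pi) auto
    ultimately show False by simp
  qed
  moreover have "0 \<le> integral\<^sup>L lebesgue ?h" using nn by (intro integral_nonneg_AE) auto
  ultimately show ?thesis by simp
qed

text \<open>The description in \<open>frac_const\<close> is satisfied by 1/A, where \<open>A\<close>
  is the integral for a unit vector. Testing it with the frequency \<open>?e\<close> at the point 0
  shows that no other value satisfies it.\<close>

lemma frac_const_pos:
  assumes \<sigma>: "0 < \<sigma>" "\<sigma> < 1"
  shows "0 < frac_const TYPE(real ^ 'n) \<sigma>"
proof -
  let ?e = "axis undefined 1 :: real ^ 'n"
  define A where "A = (\<integral>z. (1 - cos (?e \<bullet> z)) * rkernel \<sigma> z \<partial>lebesgue)"
  have e: "norm ?e = 1" by simp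
  have A: "0 < A" unfolding A_def by (rule integral_one_minus_cos_rkernel_pos[OF \<sigma> e])
  have pv: "pv_integral \<sigma> (\<lambda>y. cis (\<xi> \<bullet> y)) x = (norm \<xi> powr (2 * \<sigma>) * A) *\<^sub>R cis (\<xi> \<bullet> x)"
    for \<xi> x :: "real ^ 'n"
    using pv_integral_cis(1)[OF \<sigma>, of \<xi> x] integral_one_minus_cos_rkernel[OF \<sigma>(1) e, of \<xi>]
    by (simp add: A_def)
  have "frac_const TYPE(real ^ 'n) \<sigma> = 1 / A"
    unfolding frac_const_def
  proof (rule the_equality)
    show "0 < 1 / A \<and> (\<forall>(\<xi>::real^'n) x. (1 / A) *\<^sub>R pv_integral \<sigma> (\<lambda>y. cis (\<xi> \<bullet> y)) x
        = (norm \<xi> powr (2 * \<sigma>)) *\<^sub>R cis (\<xi> \<bullet> x))"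
      using A by (simp add: pv)
    fix c assume "0 < c \<and> (\<forall>(\<xi>::real^'n) x. c *\<^sub>R pv_integral \<sigma> (\<lambda>y. cis (\<xi> \<bullet> y)) x
        = (norm \<xi> powr (2 * \<sigma>)) *\<^sub>R cis (\<xi> \<bullet> x))"
    then have "c *\<^sub>R pv_integral \<sigma> (\<lambda>y. cis (?e \<bullet> y)) 0 = (norm ?e powr (2 * \<sigma>)) *\<^sub>R cis (?e \<bullet> 0)"
      by blast
    then have "c * A = 1" unfolding pv e by (simp add: complex_eq_iff)
    then show "c = 1 / A" using A by (simp add: field_simps)
  qed
  then show ?thesis using A by simp
qed

section \<open>Classical second order calculus and the boundary\<close>

lemma C2_on_differentiable:
  assumes "C2_on S u" "x \<in> S"
  shows "u differentiable (at x)"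
  using assms unfolding C2_on_def by (blast intro: differentiableI)

lemma C2_on_continuous_on:
  assumes "C2_on S u"
  shows "continuous_on S u"
  using assms by (intro continuous_at_imp_continuous_on)
    (blast intro: differentiable_imp_continuous_within C2_on_differentiable)

lemma C2_on_subset:
  assumes u: "C2_on S u" and "T \<subseteq> S"
  shows "C2_on T u"
proof -
  obtain u' u'' where d: "\<And>x. x \<in> S \<Longrightarrow> (u has_derivative blinfun_apply (u' x)) (at x)"
      "\<And>x. x \<in> S \<Longrightarrow> (u' has_derivative blinfun_apply (u'' x)) (at x)" "continuous_on S u''"
    using u unfolding C2_on_def by blast
  show ?thesis
    unfolding C2_on_def using assms(2)
    by (intro exI[of _ u'] exI[of _ u''] conjI ballI d(1,2) continuous_on_subset[OF d(3)]) auto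
qed

section \<open>The boundary is a null set\<close>

text \<open>By invariance of \<gamma> along \<nu>, the graph is the image of the hyperplane
  orthogonal to \<nu> under the differentiable map y -> y + \<gamma>(y) \<nu>, and such maps send
  null sets to null sets.\<close>

lemma negligible_C2_graph:
  fixes \<gamma> :: "'a::euclidean_space \<Rightarrow> real"
  assumes \<nu>: "norm \<nu> = 1" and \<gamma>: "C2_on UNIV \<gamma>" and inv: "\<And>x t. \<gamma> (x + t *\<^sub>R \<nu>) = \<gamma> x"
  shows "negligible {x. \<gamma> x = x \<bullet> \<nu>}"
proof (rule negligible_subset)
  let ?H = "{x. \<nu> \<bullet> x = 0}"
  have d: "\<gamma> differentiable (at x)" for x using C2_on_differentiable[OF \<gamma>] by simp
  show "negligible ((\<lambda>y. y + \<gamma> y *\<^sub>R \<nu>) ` ?H)"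
  proof (rule negligible_differentiable_image_negligible[OF order_refl])
    show "negligible ?H" using \<nu> by (intro negligible_hyperplane) auto
    show "(\<lambda>y. y + \<gamma> y *\<^sub>R \<nu>) differentiable_on ?H"
      using d by (intro differentiable_at_imp_differentiable_on differentiable_add differentiable_scaleR) auto
  qed
  show "{x. \<gamma> x = x \<bullet> \<nu>} \<subseteq> (\<lambda>y. y + \<gamma> y *\<^sub>R \<nu>) ` ?H"
  proof
    fix x assume x: "x \<in> {x. \<gamma> x = x \<bullet> \<nu>}"
    let ?y = "x + (- (x \<bullet> \<nu>)) *\<^sub>R \<nu>"
    have "?y \<in> ?H" using \<nu> by (simp add: inner_diff_right inner_commute dot_square_norm)
    moreover have "x = ?y + \<gamma> ?y *\<^sub>R \<nu>" using x unfolding inv by simp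
    ultimately show "x \<in> (\<lambda>y. y + \<gamma> y *\<^sub>R \<nu>) ` ?H" by blast
  qed
qed

text \<open>In a chart, the open region above the graph lies in the interior of \<open>S\<close> and
  the open region below misses \<open>S\<close>, hence also its closure; so the frontier lies in the
  graph. Compactness leaves finitely many charts. The comparison argument needs this because it has
  no information on the values of the functions on the frontier itself.\<close>

lemma C2_boundary_negligible_frontier:
  fixes S :: "'a::euclidean_space set"
  assumes S: "bounded S" "C2_boundary S"
  shows "negligible (frontier S)"
proof -
  have "\<exists>r>0. negligible (frontier S \<inter> ball x0 r)" if x0: "x0 \<in> frontier S" for x0
  proof -
    have "\<exists>\<nu> r \<gamma>. norm \<nu> = 1 \<and> 0 < r \<and> C2_on UNIV \<gamma> \<and>
       (\<forall>x t. \<gamma> (x + t *\<^sub>R \<nu>) = \<gamma> x) \<and>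
       S \<inter> ball x0 r = {x \<in> ball x0 r. \<gamma> x < x \<bullet> \<nu>}"
      using S(2)[unfolded C2_boundary_def] x0 by (rule bspec)
    then obtain \<nu> r \<gamma> where *: "norm \<nu> = 1" "0 < r" "C2_on UNIV \<gamma>" "\<And>x t. \<gamma> (x + t *\<^sub>R \<nu>) = \<gamma> x"
      and eq: "S \<inter> ball x0 r = {x \<in> ball x0 r. \<gamma> x < x \<bullet> \<nu>}"
      by (elim exE conjE) simp
    have c: "continuous_on UNIV \<gamma>" using *(3) by (rule C2_on_continuous_on)
    have "frontier S \<inter> ball x0 r \<subseteq> {x. \<gamma> x = x \<bullet> \<nu>}"
    proof
      fix x assume x: "x \<in> frontier S \<inter> ball x0 r"
      let ?U = "ball x0 r \<inter> {x. \<gamma> x < x \<bullet> \<nu>}" and ?V = "ball x0 r \<inter> {x. x \<bullet> \<nu> < \<gamma> x}"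
      have oU: "open ?U" by (intro open_Int open_ball open_Collect_less c continuous_intros)
      have oV: "open ?V" by (intro open_Int open_ball open_Collect_less c continuous_intros)
      have "?U \<subseteq> S" using eq by blast
      then have "?U \<subseteq> interior S" using oU by (rule interior_maximal)
      moreover have "x \<notin> interior S" using x by (simp add: frontier_def)
      ultimately have "x \<notin> ?U" by blast
      moreover have "S \<inter> ?V = {}"
      proof (rule equals0I)
        fix y assume y: "y \<in> S \<inter> ?V"
        then have "y \<in> {x \<in> ball x0 r. \<gamma> x < x \<bullet> \<nu>}" using eq by blast
        then show False using y by simp
      qed
      then have "x \<notin> ?V" using x open_Int_closure_eq_empty[OF oV, of S] by (auto simp: frontier_def)
      ultimately show "x \<in> {x. \<gamma> x = x \<bullet> \<nu>}" using x by auto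
    qed
    then show ?thesis using *(2) negligible_subset[OF negligible_C2_graph[OF *(1,3,4)]] by blast
  qed
  then obtain r where r: "\<And>x0. x0 \<in> frontier S \<Longrightarrow> 0 < r x0 \<and> negligible (frontier S \<inter> ball x0 (r x0))"
    by metis
  have cpt: "compact (frontier S)" using S(1) by (rule compact_frontier_bounded)
  have cov: "frontier S \<subseteq> (\<Union>x\<in>frontier S. ball x (r x))" using r by (intro subsetI UN_I) auto
  obtain F where F: "F \<subseteq> frontier S" "finite F" "frontier S \<subseteq> (\<Union>x\<in>F. ball x (r x))"
    by (rule compactE_image[OF cpt open_ball cov])
  have "negligible (\<Union>((\<lambda>x. frontier S \<inter> ball x (r x)) ` F))"
    using F r by (intro negligible_Union) auto
  then show ?thesis by (rule negligible_subset) (use F(3) in blast)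
qed

section \<open>The Laplacian of a function of class C^2\<close>

lemma has_real_derivative_partial:
  fixes u :: "'a::euclidean_space \<Rightarrow> real"
  assumes "(u has_derivative D) (at (x + t *\<^sub>R b))"
  shows "((\<lambda>t. u (x + t *\<^sub>R b)) has_real_derivative D b) (at t)"
proof -
  have "((\<lambda>t. x + t *\<^sub>R b) has_derivative (\<lambda>h. h *\<^sub>R b)) (at t)"
    by (auto intro!: derivative_eq_intros)
  then have "((\<lambda>t. u (x + t *\<^sub>R b)) has_derivative (\<lambda>h. D (h *\<^sub>R b))) (at t)"
    by (rule has_derivative_compose) (rule assms)
  then show ?thesis
    using linear_cmul[OF has_derivative_linear[OF assms]]
    by (simp add: has_field_derivative_def mult_commute_abs)
qed

lemma line_stays_in_open:
  fixes x b :: "'a::real_normed_vector"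
  assumes "open S" "x \<in> S"
  obtains d :: real where "0 < d" "\<And>t. \<bar>t\<bar> < d \<Longrightarrow> x + t *\<^sub>R b \<in> S"
proof -
  obtain e where e: "0 < e" "ball x e \<subseteq> S" using assms openE by blast
  \<comment> \<open>The summand 1 covers b = 0.\<close>
  have "x + t *\<^sub>R b \<in> S" if "\<bar>t\<bar> < e / (norm b + 1)" for t
  proof -
    have "\<bar>t\<bar> * norm b \<le> \<bar>t\<bar> * (norm b + 1)" by (simp add: mult_left_mono)
    also have "\<dots> < e" using that by (simp add: pos_less_divide_eq add_nonneg_pos)
    finally show ?thesis using e(2) by (auto simp: dist_norm)
  qed
  moreover have "0 < e / (norm b + 1)" using e(1) by (simp add: add_nonneg_pos)
  ultimately show thesis using that by blast
qed

text \<open>The trace of the second Frechet derivative. The outer derivative sees the first partial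
  derivatives only near \<open>x\<close>, where openness of \<open>S\<close> allows them to be
  replaced by the values of u'.\<close>

lemma laplacian_eq:
  fixes u :: "'a::euclidean_space \<Rightarrow> real" and u' :: "'a \<Rightarrow> 'a \<Rightarrow>\<^sub>L real"
  assumes S: "open S" "x \<in> S"
    and d1: "\<And>y. y \<in> S \<Longrightarrow> (u has_derivative u' y) (at y)"
    and d2: "(u' has_derivative blinfun_apply u'') (at x)"
  shows "laplacian u x = (\<Sum>b\<in>Basis. u'' b b)"
  unfolding laplacian_def
proof (rule sum.cong[OF refl])
  fix b :: 'a
  have p1: "partial_deriv b u y = u' y b" if "y \<in> S" for y
    unfolding partial_deriv_def
    using d1[OF that] by (intro DERIV_imp_deriv has_real_derivative_partial) simp
  obtain d where d: "0 < d" "\<And>t. \<bar>t\<bar> < d \<Longrightarrow> x + t *\<^sub>R b \<in> S"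
    using line_stays_in_open[OF S] by metis
  have "((\<lambda>y. u' y b) has_derivative (\<lambda>h. u'' h b)) (at (x + 0 *\<^sub>R b))"
    using bounded_linear.has_derivative[OF blinfun.bounded_linear_left d2] by simp
  then have "((\<lambda>t. u' (x + t *\<^sub>R b) b) has_real_derivative u'' b b) (at 0)"
    by (rule has_real_derivative_partial)
  moreover have "\<forall>\<^sub>F t in nhds 0. partial_deriv b u (x + t *\<^sub>R b) = u' (x + t *\<^sub>R b) b"
    using d p1 by (intro eventually_nhds_in_open[of "ball (0::real) d", THEN eventually_mono]) (auto simp: dist_norm)
  ultimately have "((\<lambda>t. partial_deriv b u (x + t *\<^sub>R b)) has_real_derivative u'' b b) (at 0)"
    by (subst DERIV_cong_ev[OF refl _ refl])
  then show "partial_deriv b (partial_deriv b u) x = u'' b b"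
    unfolding partial_deriv_def[of b "partial_deriv b u"] by (rule DERIV_imp_deriv)
qed

lemma continuous_on_laplacian:
  assumes S: "open S" and u: "C2_on S u"
  shows "continuous_on S (laplacian u)"
proof -
  obtain u' u'' where d: "\<And>x. x \<in> S \<Longrightarrow> (u has_derivative blinfun_apply (u' x)) (at x)"
      "\<And>x. x \<in> S \<Longrightarrow> (u' has_derivative blinfun_apply (u'' x)) (at x)" "continuous_on S u''"
    using u unfolding C2_on_def by blast
  have "continuous_on S (\<lambda>x. \<Sum>b\<in>Basis. u'' x b b)"
    using d(3) by (intro continuous_intros)
  then show ?thesis
    using laplacian_eq[OF S _ d(1,2)] by (simp cong: continuous_on_cong)
qed

lemma
  assumes S: "open S" and u: "C2_on S u" and v: "C2_on S v"
  shows C2_on_diff: "C2_on S (\<lambda>x. u x - v x)"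
    and laplacian_diff: "x \<in> S \<Longrightarrow> laplacian (\<lambda>x. u x - v x) x = laplacian u x - laplacian v x"
proof -
  obtain u' u'' where d: "\<And>x. x \<in> S \<Longrightarrow> (u has_derivative blinfun_apply (u' x)) (at x)"
      "\<And>x. x \<in> S \<Longrightarrow> (u' has_derivative blinfun_apply (u'' x)) (at x)" "continuous_on S u''"
    using u unfolding C2_on_def by blast
  obtain v' v'' where e: "\<And>x. x \<in> S \<Longrightarrow> (v has_derivative blinfun_apply (v' x)) (at x)"
      "\<And>x. x \<in> S \<Longrightarrow> (v' has_derivative blinfun_apply (v'' x)) (at x)" "continuous_on S v''"
    using v unfolding C2_on_def by blast
  have f1: "((\<lambda>x. u x - v x) has_derivative blinfun_apply (u' x - v' x)) (at x)" if "x \<in> S" for x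
    using has_derivative_diff[OF d(1) e(1)] that by (simp add: blinfun.diff_left[abs_def])
  have f2: "((\<lambda>x. u' x - v' x) has_derivative blinfun_apply (u'' x - v'' x)) (at x)" if "x \<in> S" for x
    using has_derivative_diff[OF d(2) e(2)] that by (simp add: blinfun.diff_left[abs_def])
  show "C2_on S (\<lambda>x. u x - v x)"
    unfolding C2_on_def
    by (intro exI[of _ "\<lambda>x. u' x - v' x"] exI[of _ "\<lambda>x. u'' x - v'' x"] conjI ballI f1 f2
        continuous_on_diff d(3) e(3))
  show "laplacian (\<lambda>x. u x - v x) x = laplacian u x - laplacian v x" if x: "x \<in> S"
    using laplacian_eq[OF S x f1 f2[OF x]] laplacian_eq[OF S x d(1) d(2)[OF x]] laplacian_eq[OF S x e(1) e(2)[OF x]]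
    by (simp add: blinfun.diff_left sum_subtractf)
qed

text \<open>If \<open>c\<close> were positive, g' would vanish at 0 and be positive just to the
  right of it, and the mean value theorem would give g h > g 0 for some small h > 0.\<close>

lemma second_derivative_nonpos_at_max:
  fixes g g' :: "real \<Rightarrow> real"
  assumes d: "0 < d" and g: "\<And>t. \<bar>t\<bar> < d \<Longrightarrow> (g has_real_derivative g' t) (at t)"
    and g': "(g' has_real_derivative c) (at 0)" and max: "\<And>t. \<bar>t\<bar> < d \<Longrightarrow> g t \<le> g 0"
  shows "c \<le> 0"
proof (rule ccontr)
  assume "\<not> c \<le> 0"
  then have "0 < c" by simp
  have "g' 0 = 0" using d by (intro DERIV_local_max[OF g[of 0] d]) (auto simp: max)
  then obtain e where e: "0 < e" "\<And>h. 0 < h \<Longrightarrow> h < e \<Longrightarrow> 0 < g' h"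
    using DERIV_pos_inc_right[OF g' \<open>0 < c\<close>] by auto
  define h where "h = min d e / 2"
  have h: "0 < h" "h < d" "h < e" using d e(1) by (auto simp: h_def min_def)
  obtain z where z: "0 < z" "z < h" "g h - g 0 = (h - 0) * g' z"
    using MVT2[of 0 h g g'] h g by auto
  then have "0 < g h - g 0" using e(2)[of z] h by simp
  then show False using max[of h] h by simp
qed

text \<open>Along each coordinate direction the perturbed function has nonpositive second
  derivative, and \<epsilon> |y|^2 contributes exactly 2 \<epsilon> to it.\<close>

lemma laplacian_at_perturbed_max:
  fixes u :: "'a::euclidean_space \<Rightarrow> real"
  assumes S: "open S" "x \<in> S" and u: "C2_on S u"
    and max: "\<And>y. y \<in> S \<Longrightarrow> u y + \<epsilon> * (y \<bullet> y) \<le> u x + \<epsilon> * (x \<bullet> x)"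
  shows "laplacian u x \<le> - 2 * \<epsilon> * real DIM('a)"
proof -
  obtain u' u'' where d1: "\<And>x. x \<in> S \<Longrightarrow> (u has_derivative blinfun_apply (u' x)) (at x)"
    and d2: "\<And>x. x \<in> S \<Longrightarrow> (u' has_derivative blinfun_apply (u'' x)) (at x)"
    using u unfolding C2_on_def by blast
  have "u'' x b b \<le> - 2 * \<epsilon>" if b: "b \<in> Basis" for b
  proof -
    obtain d where d: "0 < d" "\<And>t. \<bar>t\<bar> < d \<Longrightarrow> x + t *\<^sub>R b \<in> S"
      using line_stays_in_open[OF S] by metis
    let ?q = "\<lambda>t. \<epsilon> * (x \<bullet> x + 2 * t * (x \<bullet> b) + t\<^sup>2)"
    have q: "\<epsilon> * ((x + t *\<^sub>R b) \<bullet> (x + t *\<^sub>R b)) = ?q t" for t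
      using b by (simp add: inner_add_left inner_add_right inner_commute power2_eq_square algebra_simps)
    have "((\<lambda>y. u' y b) has_derivative (\<lambda>h. u'' x h b)) (at (x + 0 *\<^sub>R b))"
      using bounded_linear.has_derivative[OF blinfun.bounded_linear_left d2[OF S(2)]] by simp
    then have u2: "((\<lambda>t. u' (x + t *\<^sub>R b) b) has_real_derivative u'' x b b) (at 0)"
      by (rule has_real_derivative_partial)
    have "u'' x b b + 2 * \<epsilon> \<le> 0"
    proof (rule second_derivative_nonpos_at_max[OF d(1)])
      show "((\<lambda>t. u (x + t *\<^sub>R b) + ?q t) has_real_derivative u' (x + t *\<^sub>R b) b + \<epsilon> * (2 * (x \<bullet> b) + 2 * t)) (at t)"
        if "\<bar>t\<bar> < d" for t
        by (rule DERIV_add[OF has_real_derivative_partial[OF d1[OF d(2)[OF that]]]])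
          (auto intro!: derivative_eq_intros)
      show "((\<lambda>t. u' (x + t *\<^sub>R b) b + \<epsilon> * (2 * (x \<bullet> b) + 2 * t)) has_real_derivative u'' x b b + 2 * \<epsilon>) (at 0)"
        by (rule DERIV_add[OF u2]) (auto intro!: derivative_eq_intros)
      show "u (x + t *\<^sub>R b) + ?q t \<le> u (x + 0 *\<^sub>R b) + ?q 0" if "\<bar>t\<bar> < d" for t
        using max[OF d(2)[OF that]] unfolding q by simp
    qed
    then show ?thesis by simp
  qed
  then have "(\<Sum>b\<in>Basis. u'' x b b) \<le> (\<Sum>b\<in>(Basis::'a set). - 2 * \<epsilon>)" by (rule sum_mono)
  then show ?thesis using laplacian_eq[OF S d1 d2[OF S(2)]] by (simp add: mult.commute)
qed

section \<open>The comparison principle\<close>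

text \<open>At a positive global maximum of \<open>u - v\<close> the difference \<open>u x0 - v x0 - (u y - v y)\<close> is
  nonnegative for a.e. \<open>y\<close>, and it is at least \<open>u x0 - v x0\<close> for \<open>y\<close> far away.\<close>

lemma pv_integral_less_at_max:
  fixes u v :: "'a::euclidean_space \<Rightarrow> real"
  assumes \<sigma>: "0 < \<sigma>" "\<sigma> < 1" and S: "open S" "bounded S" "x0 \<in> S"
    and u: "C2_on S u" "u \<in> L1_weighted \<sigma>" and v: "C2_on S v" "v \<in> L1_weighted \<sigma>"
    and pos: "v x0 < u x0"
    and max: "AE y in lebesgue. u y - v y \<le> u x0 - v x0"
    and ext: "AE y in lebesgue. y \<notin> closure S \<longrightarrow> u y \<le> v y"
  shows "pv_integral \<sigma> v x0 < pv_integral \<sigma> u x0"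
proof -
  let ?k = "\<lambda>y. rkernel \<sigma> (y - x0)"
  define M where "M = u x0 - v x0"
  obtain R where R: "0 < R" "closure S \<subseteq> ball x0 R"
    using bounded_subset_ballD[OF bounded_closure[OF S(2)]] by metis
  define J where "J f \<epsilon> y = indicat_real (- ball x0 \<epsilon>) y * (?k y * (f x0 - f y))" for f :: "'a \<Rightarrow> real" and \<epsilon> y
  have km: "?k \<in> borel_measurable lebesgue"
    using borel_measurable_lebesgue_shift[OF borel_measurable_rkernel_lebesgue, of \<sigma> "- x0"] by simp
  have tm: "(\<lambda>y. indicat_real (- ball x0 \<epsilon>) y * ?k y) \<in> borel_measurable lebesgue" for \<epsilon>
    using km by (intro borel_measurable_times borel_measurable_indicator) auto
  have tail: "integrable lebesgue (\<lambda>y. indicat_real (- ball x0 \<epsilon>) y * ?k y)" if "0 < \<epsilon>" for \<epsilon>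
  proof -
    have "integrable lebesgue (\<lambda>z. indicat_real (- ball x0 \<epsilon>) (x0 + z) * ?k (x0 + z))"
      using integrable_rkernel_tail[OF \<sigma>(1) that] by (simp add: indicator_def dist_norm)
    then show ?thesis using integrable_lebesgue_shift_iff[OF tm[of \<epsilon>], of x0] by simp
  qed
  have J: "integrable lebesgue (J f \<epsilon>)" if "f \<in> L1_weighted \<sigma>" "0 < \<epsilon>" for f \<epsilon>
  proof -
    have "J f \<epsilon> = (\<lambda>y. f x0 * (indicat_real (- ball x0 \<epsilon>) y * ?k y)
        - indicat_real (- ball x0 \<epsilon>) y * (?k y * f y))"
      by (simp add: J_def[abs_def] algebra_simps)
    then show ?thesis using tail[OF that(2)] L1_weighted_far_integrable(1)[OF \<sigma>(1) that]
      by simp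
  qed
  have JI: "(LINT y:(- ball x0 \<epsilon>)|lebesgue. (f x0 - f y) /\<^sub>R (norm (x0 - y) powr (real DIM('a) + 2 * \<sigma>)))
      = integral\<^sup>L lebesgue (J f \<epsilon>)" for f \<epsilon>
    by (simp add: set_lebesgue_integral_def J_def[abs_def] rkernel_def norm_minus_commute)
  \<comment> \<open>A lower bound for the contribution of the complement of
    \<open>ball x0 R\<close>, where u \<le> v almost everywhere. It does not depend on the
    truncation radius \<epsilon> < R, so the strict inequality survives the limit.\<close>
  define c where "c = (\<integral>y. M * (indicat_real (- ball x0 R) y * ?k y) \<partial>lebesgue)"
  have M: "0 < M" using pos by (simp add: M_def)
  have ci: "integrable lebesgue (\<lambda>y. M * (indicat_real (- ball x0 R) y * ?k y))"
    using tail[OF R(1)] by simp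
  have cn: "0 \<le> M * (indicat_real (- ball x0 R) y * ?k y)" for y
    using M by (simp add: rkernel_nonneg)
  have "c \<noteq> 0"
  proof
    assume "c = 0"
    then have "AE y in lebesgue. M * (indicat_real (- ball x0 R) y * ?k y) = 0"
      using integral_nonneg_eq_0_iff_AE[OF ci] cn unfolding c_def by auto
    moreover have "open (- cball x0 R)" by (simp add: open_Compl)
    moreover have "cball x0 R \<noteq> UNIV" using not_compact_UNIV compact_cball by metis
    then have "- cball x0 R \<noteq> {}" by blast
    ultimately obtain y where y: "y \<in> - cball x0 R" "M * (indicat_real (- ball x0 R) y * ?k y) = 0"
      using AE_lebesgue_open_ex by blast
    then have "y - x0 \<noteq> 0" using R(1) by auto
    then show False using y M rkernel_pos[of "y - x0" \<sigma>] by simp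
  qed
  moreover have "0 \<le> c" unfolding c_def using cn by (intro integral_nonneg_AE) auto
  ultimately have c: "0 < c" by simp
  have le: "c \<le> integral\<^sup>L lebesgue (J u \<epsilon>) - integral\<^sup>L lebesgue (J v \<epsilon>)" if \<epsilon>: "0 < \<epsilon>" "\<epsilon> < R" for \<epsilon>
  proof -
    have "c \<le> (\<integral>y. J u \<epsilon> y - J v \<epsilon> y \<partial>lebesgue)"
      unfolding c_def
    proof (rule integral_mono_AE[OF ci])
      show "integrable lebesgue (\<lambda>y. J u \<epsilon> y - J v \<epsilon> y)" using J u v \<epsilon> by simp
      show "AE y in lebesgue. M * (indicat_real (- ball x0 R) y * ?k y) \<le> J u \<epsilon> y - J v \<epsilon> y"
        using max ext
      proof eventually_elim
        case (elim y)
        have Jd: "J u \<epsilon> y - J v \<epsilon> y = indicat_real (- ball x0 \<epsilon>) y * (?k y * (M - (u y - v y)))"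
          by (simp add: J_def M_def algebra_simps)
        show ?case
        proof (cases "y \<in> ball x0 R")
          case True
          then show ?thesis unfolding Jd using elim(1) by (simp add: M_def rkernel_nonneg)
        next
          case False
          then have "u y \<le> v y" using elim(2) R(2) by blast
          then have "M \<le> M - (u y - v y)" by simp
          then have "?k y * M \<le> ?k y * (M - (u y - v y))" by (intro mult_left_mono rkernel_nonneg)
          then show ?thesis unfolding Jd using False \<epsilon> by (simp add: mult.commute)
        qed
      qed
    qed
    then show ?thesis using J u v \<epsilon> by simp
  qed
  have "((\<lambda>\<epsilon>. integral\<^sup>L lebesgue (J u \<epsilon>) - integral\<^sup>L lebesgue (J v \<epsilon>)) \<longlongrightarrow> pv_integral \<sigma> u x0 - pv_integral \<sigma> v x0) (at_right 0)"
    using pv_integral_C2(1)[OF \<sigma> S(1,3) u] pv_integral_C2(1)[OF \<sigma> S(1,3) v] unfolding JI by (rule tendsto_diff)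
  moreover have "\<forall>\<^sub>F \<epsilon> in at_right 0. c \<le> integral\<^sup>L lebesgue (J u \<epsilon>) - integral\<^sup>L lebesgue (J v \<epsilon>)"
    using R(1) by (auto simp: eventually_at_right_field intro!: exI[of _ R] le)
  ultimately have "c \<le> pv_integral \<sigma> u x0 - pv_integral \<sigma> v x0"
    by (rule tendsto_lowerbound) simp
  then show ?thesis using c by simp
qed

text \<open>A real \<open>c\<close> is chosen with limsup f < c + m/2 and c - m/2 < liminf g: a
  finite one of the two limits if there is one, and 0 otherwise.\<close>

lemma eventually_diff_less_Limsup_Liminf:
  fixes f g :: "'a \<Rightarrow> real"
  assumes F: "F \<noteq> bot" and f: "Limsup F (\<lambda>x. ereal (f x)) < \<infinity>"
    and le: "Limsup F (\<lambda>x. ereal (f x)) \<le> Liminf F (\<lambda>x. ereal (g x))"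
    and g: "- \<infinity> < Liminf F (\<lambda>x. ereal (g x))" and m: "0 < m"
  shows "\<forall>\<^sub>F x in F. f x - g x < m"
proof -
  obtain c :: real where c: "Limsup F (\<lambda>x. ereal (f x)) < ereal (c + m / 2)"
    "ereal (c - m / 2) < Liminf F (\<lambda>x. ereal (g x))"
  proof (cases "Limsup F (\<lambda>x. ereal (f x))"; cases "Liminf F (\<lambda>x. ereal (g x))")
    fix a b assume "Limsup F (\<lambda>x. ereal (f x)) = ereal a" "Liminf F (\<lambda>x. ereal (g x)) = ereal b"
    then show thesis using le m that[of a] by simp
  next
    fix a assume "Limsup F (\<lambda>x. ereal (f x)) = ereal a" "Liminf F (\<lambda>x. ereal (g x)) = \<infinity>"
    then show thesis using m that[of a] by simp
  next
    fix b assume "Limsup F (\<lambda>x. ereal (f x)) = - \<infinity>" "Liminf F (\<lambda>x. ereal (g x)) = ereal b"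
    then show thesis using m that[of b] by simp
  next
    assume "Limsup F (\<lambda>x. ereal (f x)) = - \<infinity>" "Liminf F (\<lambda>x. ereal (g x)) = \<infinity>"
    then show thesis using that[of 0] by simp
  qed (use f g in auto)
  show ?thesis using Limsup_lessD[OF c(1)] less_LiminfD[OF c(2)]
  proof eventually_elim
    case (elim x)
    then have "f x < c + m / 2" "c - m / 2 < g x" by simp_all
    then show ?case by simp
  qed
qed

text \<open>A limit of points of this set cannot lie on the frontier, near which w < c, so it lies
  in \<open>S\<close>, where continuity applies.\<close>

lemma compact_superlevel:
  fixes w :: "'a::euclidean_space \<Rightarrow> real"
  assumes S: "open S" "bounded S" and w: "continuous_on S w"
    and bd: "\<And>x0. x0 \<in> frontier S \<Longrightarrow> \<forall>\<^sub>F x in at x0 within S. w x < c"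
  shows "compact {x \<in> S. c \<le> w x}"
proof -
  have "closed {x \<in> S. c \<le> w x}"
    unfolding closed_sequential_limits
  proof (intro allI impI)
    fix X l assume X: "(\<forall>n. X n \<in> {x \<in> S. c \<le> w x}) \<and> X \<longlonglongrightarrow> l"
    have XS: "X n \<in> S" "c \<le> w (X n)" for n using X by auto
    have lc: "l \<in> closure S" using XS(1) X closure_sequential by blast
    have l: "l \<in> S"
    proof (rule ccontr)
      assume "l \<notin> S"
      then have "l \<in> frontier S" using lc S(1) by (simp add: frontier_def interior_open)
      from bd[OF this] have "\<forall>\<^sub>F n in sequentially. w (X n) < c"
      proof (rule eventually_compose_filterlim)
        show "filterlim X (at l within S) sequentially"
          using X XS(1) \<open>l \<notin> S\<close> by (auto simp: filterlim_at intro!: always_eventually)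
      qed
      then have "\<exists>n. w (X n) < c" using eventually_happens'[OF sequentially_bot] by blast
      then show False using XS(2) by (simp add: not_less[symmetric])
    qed
    have "(\<lambda>n. w (X n)) \<longlonglongrightarrow> w l"
      using X XS(1) by (intro continuous_on_tendsto_compose[OF w _ l]) auto
    then have "c \<le> w l" using XS(2) by (intro LIMSEQ_le_const) auto
    then show "l \<in> {x \<in> S. c \<le> w x}" using l by simp
  qed
  moreover have "bounded {x \<in> S. c \<le> w x}" using S(2) by (rule bounded_subset) blast
  ultimately show ?thesis by (simp add: compact_eq_bounded_closed)
qed

lemma nonneg_of_AE_continuous:
  fixes f :: "'a::euclidean_space \<Rightarrow> real"
  assumes B: "open B" and f: "continuous_on B f" and ae: "AE x in lebesgue. x \<in> B \<longrightarrow> 0 \<le> f x" and x: "x \<in> B"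
  shows "0 \<le> f x"
proof (rule ccontr)
  assume "\<not> 0 \<le> f x"
  have "open (f -` {..<0} \<inter> B)" using continuous_open_preimage[OF f B, of "{..<0}"] by (simp add: Int_commute)
  moreover have "x \<in> f -` {..<0} \<inter> B" using x \<open>\<not> 0 \<le> f x\<close> by simp
  then have "f -` {..<0} \<inter> B \<noteq> {}" by blast
  ultimately obtain y where "y \<in> f -` {..<0} \<inter> B" "y \<in> B \<longrightarrow> 0 \<le> f y"
    using AE_lebesgue_open_ex[OF ae] by blast
  then show False by simp
qed

theorem proposition1p2:
  fixes \<sigma> :: real
    and \<Omega> :: "(real ^ 'n) set"
    and \<Phi> :: "real ^ 'n \<Rightarrow> real \<Rightarrow> real"
    and w1 w2 :: "real ^ 'n \<Rightarrow> real"
  assumes sigma: "0 < \<sigma>" "\<sigma> < 1"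
    and Omega: "open \<Omega>" "bounded \<Omega>" "C2_boundary \<Omega>"
    and Phi: "caratheodory_fun \<Omega> \<Phi>" "AE x in lebesgue_on \<Omega>. mono (\<Phi> x)"
    and w1: "w1 \<in> L1_weighted \<sigma>" "C2_on \<Omega> w1"
    and w2: "w2 \<in> L1_weighted \<sigma>" "C2_on \<Omega> w2"
    and interior_ineq: "\<forall>x\<in>\<Omega>. - laplacian w1 x + \<Phi> x (frac_laplacian \<sigma> w1 x)
                              \<le> - laplacian w2 x + \<Phi> x (frac_laplacian \<sigma> w2 x)"
    and exterior_ineq: "AE x in lebesgue. x \<notin> closure \<Omega> \<longrightarrow> w1 x \<le> w2 x"
    and boundary_ineq: "\<forall>x0\<in>frontier \<Omega>.
          Limsup (at x0 within \<Omega>) (\<lambda>x. ereal (w1 x)) < \<infinity> \<and>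
          Limsup (at x0 within \<Omega>) (\<lambda>x. ereal (w1 x))
            \<le> Liminf (at x0 within \<Omega>) (\<lambda>x. ereal (w2 x)) \<and>
          - \<infinity> < Liminf (at x0 within \<Omega>) (\<lambda>x. ereal (w2 x))"
  shows "\<forall>x\<in>\<Omega>. w1 x \<le> w2 x"
proof (rule ccontr)
  assume "\<not> ?thesis"
  then obtain x1 where x1: "x1 \<in> \<Omega>" "w2 x1 < w1 x1" by auto
  define w where "w x = w1 x - w2 x" for x
  have C2: "C2_on \<Omega> w" unfolding w_def[abs_def] using Omega(1) w1(2) w2(2) by (rule C2_on_diff)
  have cw: "continuous_on \<Omega> w" using C2 by (rule C2_on_continuous_on)
  have lapw: "laplacian w x = laplacian w1 x - laplacian w2 x" if "x \<in> \<Omega>" for x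
    unfolding w_def[abs_def] using Omega(1) w1(2) w2(2) that by (rule laplacian_diff)
  have cpt: "compact {x \<in> \<Omega>. c \<le> w x}" if "0 < c" for c
  proof (rule compact_superlevel[OF Omega(1,2) cw])
    fix x0 assume x0: "x0 \<in> frontier \<Omega>"
    then have "x0 \<notin> \<Omega>" "x0 \<in> closure \<Omega>" using Omega(1) by (auto simp: frontier_def interior_open)
    then have "at x0 within \<Omega> \<noteq> bot"
      by (simp add: trivial_limit_within islimpt_in_closure)
    then show "\<forall>\<^sub>F x in at x0 within \<Omega>. w x < c"
      unfolding w_def using bspec[OF boundary_ineq x0] that
      by (intro eventually_diff_less_Limsup_Liminf) auto
  qed
  have "0 < w x1" using x1(2) by (simp add: w_def)
  \<comment> \<open>A maximum over the compact set of points with w \<ge> w x1. It is a maximum over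
    all of \<Omega>, since \<open>w\<close> is smaller at the remaining points.\<close>
  then obtain x0 where x0: "x0 \<in> \<Omega>" "w x1 \<le> w x0" "\<And>y. y \<in> \<Omega> \<Longrightarrow> w x1 \<le> w y \<Longrightarrow> w y \<le> w x0"
    using continuous_attains_sup[OF cpt[of "w x1"], of w] x1(1) continuous_on_subset[OF cw]
    by (auto simp: subset_iff)
  define M where "M = w x0"
  have M: "0 < M" using x0(2) \<open>0 < w x1\<close> by (simp add: M_def)
  have wM: "w y \<le> M" if "y \<in> \<Omega>" for y
    using x0(2,3) that unfolding M_def by (meson linear order_trans)
  \<comment> \<open>Outside the closure \<open>w\<close> is nonpositive almost everywhere; the
    frontier is discarded as a null set.\<close>
  have aeM: "AE y in lebesgue. w y \<le> M"
  proof -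
    have "frontier \<Omega> \<in> null_sets lebesgue"
      using C2_boundary_negligible_frontier[OF Omega(2,3)] negligible_iff_null_sets by blast
    then have "AE y in lebesgue. y \<notin> frontier \<Omega>" by (rule AE_not_in)
    with exterior_ineq show ?thesis
    proof eventually_elim
      case (elim y)
      show ?case
      proof (cases "y \<in> \<Omega>")
        case False
        then have "y \<notin> closure \<Omega>" using elim(2) Omega(1) by (auto simp: frontier_def interior_open)
        then show ?thesis using elim(1) M by (simp add: w_def)
      qed (rule wM)
    qed
  qed
  obtain R where R: "\<And>x. x \<in> \<Omega> \<Longrightarrow> norm x \<le> R" using Omega(2) bounded_iff by metis
  define H where "H = {x \<in> \<Omega>. M / 2 \<le> w x}"
  \<comment> \<open>Chosen so that the perturbation \<epsilon> n |x|^2 is at most M / (4 (n + 1)) on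
    \<Omega>, where |x| \<le> R; the summand 1 keeps the denominator positive.\<close>
  define \<epsilon> where "\<epsilon> n = M / (4 * (R\<^sup>2 + 1)) / real (Suc n)" for n
  have den: "0 < 4 * (R\<^sup>2 + 1)" by (simp add: add_nonneg_pos)
  have \<epsilon>: "0 < \<epsilon> n" for n using M den by (simp add: \<epsilon>_def)
  have \<epsilon>R: "\<epsilon> n * R\<^sup>2 \<le> M / 4 / real (Suc n)" for n
  proof -
    have "\<epsilon> n * R\<^sup>2 \<le> \<epsilon> n * (R\<^sup>2 + 1)" using \<epsilon>[of n] by (intro mult_left_mono) auto
    also have "\<dots> = M / 4 / real (Suc n)"
    proof -
      have *: "M / (4 * a) / k * a = M / 4 / k" if "a \<noteq> 0" for a k :: real using that by simp
      show ?thesis unfolding \<epsilon>_def by (rule *) (use den in simp)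
    qed
    finally show ?thesis .
  qed
  have cH: "compact H" unfolding H_def using M by (intro cpt) simp
  have x0H: "x0 \<in> H" using x0(1) M by (simp add: H_def M_def)
  have "\<exists>x\<in>H. \<forall>y\<in>H. w y + \<epsilon> n * (y \<bullet> y) \<le> w x + \<epsilon> n * (x \<bullet> x)" for n
    using x0H continuous_on_subset[OF cw, of H]
    by (intro continuous_attains_sup cH continuous_intros) (auto simp: H_def)
  then obtain X where X: "\<And>n. X n \<in> H"
    "\<And>n y. y \<in> H \<Longrightarrow> w y + \<epsilon> n * (y \<bullet> y) \<le> w (X n) + \<epsilon> n * (X n \<bullet> X n)"
    by metis
  have X\<Omega>: "X n \<in> \<Omega>" for n using X(1) by (simp add: H_def)
  \<comment> \<open>Comparison of \<open>X n\<close> with \<open>x0\<close>, at which the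
    perturbation is nonnegative.\<close>
  have wX: "M - M / 4 / real (Suc n) \<le> w (X n)" for n
  proof -
    have "X n \<bullet> X n \<le> R\<^sup>2"
      using R[OF X\<Omega>[of n]] by (simp add: dot_square_norm power_mono)
    then have "\<epsilon> n * (X n \<bullet> X n) \<le> M / 4 / real (Suc n)"
      using \<epsilon>[of n] \<epsilon>R[of n] by (meson mult_left_mono less_imp_le order_trans)
    moreover have "0 \<le> \<epsilon> n * (x0 \<bullet> x0)" using \<epsilon>[of n] by simp
    ultimately show ?thesis using X(2)[OF x0H, of n] by (simp add: M_def)
  qed
  have lapX: "laplacian w (X n) < 0" for n
  proof -
    \<comment> \<open>Since w (X n) \<ge> 3M/4, the maximum point over the compact set
      \<open>H\<close> lies in this open subset of \<open>H\<close>, so the second order condition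
      is available.\<close>
    let ?U = "{x \<in> \<Omega>. M / 2 < w x}"
    have "open (w -` {M / 2<..} \<inter> \<Omega>)"
      using continuous_open_preimage[OF cw Omega(1), of "{M / 2<..}"] by (simp add: Int_commute)
    then have U: "open ?U" by (simp add: vimage_def Int_def conj_commute)
    have "M / 4 / real (Suc n) \<le> M / 4" using M by (simp add: divide_le_eq mult_le_cancel_left1)
    then have XU: "X n \<in> ?U" using wX[of n] M X\<Omega>[of n] by auto
    have "C2_on ?U w" using C2 by (rule C2_on_subset) blast
    then have "laplacian w (X n) \<le> - 2 * \<epsilon> n * real DIM(real ^ 'n)"
      using U XU X(2) by (intro laplacian_at_perturbed_max) (auto simp: H_def)
    also have "\<dots> < 0" using \<epsilon>[of n] by simp
    finally show ?thesis .
  qed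
  \<comment> \<open>The limit \<open>l\<close> is a maximum point of \<open>w\<close>, possibly
    different from \<open>x0\<close>; the strict inequality for the principal values is therefore
    applied at \<open>l\<close>.\<close>
  obtain l s where l: "l \<in> H" "strict_mono (s :: nat \<Rightarrow> nat)" "(X \<circ> s) \<longlonglongrightarrow> l"
    using cH X(1) unfolding compact_def by metis
  have l\<Omega>: "l \<in> \<Omega>" using l(1) by (simp add: H_def)
  have lim1: "(\<lambda>n. w ((X \<circ> s) n)) \<longlonglongrightarrow> w l"
    by (rule continuous_on_tendsto_compose[OF cw l(3) l\<Omega>]) (simp add: X\<Omega>)
  have "(\<lambda>n. M - M / 4 / real (Suc n)) \<longlonglongrightarrow> M - 0"
    by (intro tendsto_diff tendsto_const lim_const_over_n[THEN LIMSEQ_Suc])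
  from LIMSEQ_subseq_LIMSEQ[OF this l(2)]
  have "M - 0 \<le> w l"
    by (rule LIMSEQ_le[OF _ lim1]) (use wX in \<open>auto simp del: of_nat_Suc\<close>)
  then have wl: "w l = M" using wM[OF l\<Omega>] by simp
  let ?d = "\<lambda>x. pv_integral \<sigma> w1 x - pv_integral \<sigma> w2 x"
  have dl: "0 < ?d l"
    using pv_integral_less_at_max[OF sigma Omega(1,2) l\<Omega> w1(2,1) w2(2,1) _ _ exterior_ineq]
      aeM wl M by (simp add: w_def)
  have "isCont ?d l"
    using pv_integral_C2(2)[OF sigma Omega(1) l\<Omega> w1(2,1)] pv_integral_C2(2)[OF sigma Omega(1) l\<Omega> w2(2,1)]
    by (rule continuous_diff)
  then have "(?d \<longlongrightarrow> ?d l) (nhds l)" by (simp only: isCont_def tendsto_at_iff_tendsto_nhds[of ?d l])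
  then have "\<forall>\<^sub>F x in nhds l. 0 < ?d x" by (rule order_tendstoD(1)[OF _ dl])
  moreover have "\<forall>\<^sub>F x in nhds l. x \<in> \<Omega>" using Omega(1) l\<Omega> by (rule eventually_nhds_in_open)
  ultimately have "\<forall>\<^sub>F x in nhds l. 0 < ?d x \<and> x \<in> \<Omega>" by (rule eventually_conj)
  then obtain B where B: "open B" "l \<in> B" "\<And>x. x \<in> B \<Longrightarrow> 0 < ?d x \<and> x \<in> \<Omega>"
    unfolding eventually_nhds by blast
  have "AE x in lebesgue. x \<in> \<Omega> \<longrightarrow> mono (\<Phi> x)"
    using Phi(2) Omega(1) by (subst (asm) AE_restrict_space_iff) auto
  then have "AE x in lebesgue. x \<in> B \<longrightarrow> 0 \<le> laplacian w x"
  proof eventually_elim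
    case (elim x)
    show ?case
    proof
      assume x: "x \<in> B"
      \<comment> \<open>Positivity of the normalizing constant passes the inequality from the
        principal values to the operators.\<close>
      have "frac_laplacian \<sigma> w2 x \<le> frac_laplacian \<sigma> w1 x"
        unfolding frac_laplacian_def using B(3)[OF x] frac_const_pos[OF sigma, where 'n='n]
        by (intro mult_left_mono) auto
      then have "\<Phi> x (frac_laplacian \<sigma> w2 x) \<le> \<Phi> x (frac_laplacian \<sigma> w1 x)"
        using elim B(3)[OF x] by (auto dest: monoD)
      then show "0 \<le> laplacian w x"
        using bspec[OF interior_ineq, of x] B(3)[OF x] lapw[of x] by simp
    qed
  qed
  \<comment> \<open>The points X (s n) might belong to the exceptional null set, so the inequality
    is first extended to every point of \<open>B\<close>.\<close>
  moreover have "continuous_on B (laplacian w)"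
    by (rule continuous_on_subset[OF continuous_on_laplacian[OF Omega(1) C2]]) (use B(3) in blast)
  ultimately have nonneg: "0 \<le> laplacian w x" if "x \<in> B" for x
    using nonneg_of_AE_continuous[OF B(1)] that by blast
  have "\<forall>\<^sub>F n in sequentially. (X \<circ> s) n \<in> B"
    using l(3) B(1,2) by (rule topological_tendstoD)
  then obtain n where "X (s n) \<in> B" using eventually_happens'[OF sequentially_bot] by auto
  from nonneg[OF this] lapX[of "s n"] show False by simp
qed

end
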